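(* Let $\mathcal X\subset\mathbf R^n$ be a basic spectratope, let the unit ball $\mathcal B_*$ of the norm conjugate to $\|\cdot\|$ be a spectratope, and let $\mathcal Q$ be a nonempty convex compact set of positive definite $m\times m$ matrices (data and notation as in the context). Consider the convex optimization problem $$ \mathrm{Opt}=\min_{H,\Lambda,\Upsilon,\Upsilon',\Theta}\Big\{\phi_{\mathcal T}(\lambda[\Lambda])+\phi_{\mathcal R}(\lambda[\Upsilon])+\phi_{\mathcal R}(\lambda[\Upsilon'])+\Gamma(\Theta)\Big\} $$ over $H\in\mathbf R^{m\times\nu}$, $\Lambda=\{\Lambda_k\in\mathbf S^{d_k}_+\}_{k\le K}$, $\Upsilon=\{\Upsilon_\ell\in\mathbf S^{f_\ell}_+\}_{\ell\le L}$, $\Upsilon'=\{\Upsilon'_\ell\in\mathbf S^{f_\ell}_+\}_{\ell\le L}$, $\Theta\in\mathbf S^m$ subject to $$ \begin{bmatrix}\sum_k\mathcal R_k^*[\Lambda_k]&\tfrac12[B^T-A^TH]M\\ \tfrac12M^T[B-H^TA]&\sum_\ell\mathcal S_\ell^*[\Upsilon_\ell]\end{bmatrix}\succeq0,\qquad \begin{bmatrix}\Theta&\tfrac12HM\\ \tfrac12M^TH^T&\sum_\ell\mathcal S_\ell^*[\Upsilon'_\ell]\end{bmatrix}\succeq0 . $$ The problem is solvable (the minimum is attained), and the $H$-component $H_*$ of its optimal solution yields the linear estimate $\widehat x_{H_*}(\omega)=H_*^T\omega$ such that $$ \mathrm{Risk}_{\mathcal Q,\|\cdot\|}[\widehat x_{H_*}|\mathcal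 X]\le\mathrm{Opt}. $$
   Context: $\mathbf S^k$ is the space of symmetric $k\times k$ matrices, $\mathbf S^k_+$ the cone of positive semidefinite ones; $U\succeq V$ means $U-V$ is positive semidefinite. A monotonic set in $\mathbf R^K$ is a convex compact set $\mathcal T\subset\mathbf R^K_+$ which contains a vector with all entries positive and satisfies: $0\le t'\le t\in\mathcal T$ (entrywise) implies $t'\in\mathcal T$. Signal set: $\mathcal X=\{x\in\mathbf R^n:\exists t\in\mathcal T: R_k^2[x]\preceq t_kI_{d_k},\,1\le k\le K\}$ is a basic spectratope: $R_k[x]=\sum_{i=1}^n x_iR^{ki}$ with $R^{ki}\in\mathbf S^{d_k}$, $\mathcal T\subset\mathbf R^K_+$ is monotonic, and for every $x\ne0$ one has $R_k[x]\neq0$ for some $k$. Norm: $\|\cdot\|$ is a norm on $\mathbf R^\nu$ such that the unit ball $\mathcal B_*$ of the conjugate norm $\|z\|_*=\max\{z^Tu:\|u\|\le1\}$ is a spectratope: $\mathcal B_*=\{z\in\mathbf R^\nu:\exists y\in\mathcal Y: z=My\}$, $\mathcal Y=\{y\in\mathbf R^q:\exists r\in\mathcal R: S_\ell^2[y]\preceq r_\ell I_{f_\ell},1\le\ell\le L\}$, where $M\in\mathbf R^{\nu\times q}$, $S_\ell[y]=\sum_{i=1}^q y_iS^{\ell i}$ with $S^{\ell i}\in\mathbf S^{f_\ell}$, $\mathcal R\subset\mathbf R^L_+$ is monotonic, and for every $y\neq0$ one has $S_\ell[y]\ne0$ for some $\ell$. Mappings: $[\mathcal R_k^*[\Lambda_k]]_{ij}=\frac12\mathrm{Tr}(\Lambda_k[R^{ki}R^{kj}+R^{kj}R^{ki}])$,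 $1\le i,j\le n$; $[\mathcal S_\ell^*[\Upsilon_\ell]]_{ij}=\frac12\mathrm{Tr}(\Upsilon_\ell[S^{\ell i}S^{\ell j}+S^{\ell j}S^{\ell i}])$, $1\le i,j\le q$; $\lambda[\{\Xi_1,\dots,\Xi_N\}]=[\mathrm{Tr}(\Xi_1);\dots;\mathrm{Tr}(\Xi_N)]$; $\phi_{\mathcal T}(g)=\max_{t\in\mathcal T}g^Tt$, $\phi_{\mathcal R}(g)=\max_{r\in\mathcal R}g^Tr$; $\Gamma(\Theta)=\max_{Q\in\mathcal Q}\mathrm{Tr}(Q\Theta)$. Estimation problem: $A\in\mathbf R^{m\times n}$ and $B\in\mathbf R^{\nu\times n}$ are given; the goal is to recover $Bx$, $x\in\mathcal X$, from $\omega=Ax+\xi$. For a Borel probability distribution $P$ on $\mathbf R^m$ put $\mathrm{Cov}[P]=\mathbf E_{\xi\sim P}\{\xi\xi^T\}$ (non-centered), and write $P\preccurlyeq\mathcal Q$ if $\mathrm{Cov}[P]\preceq Q$ for some $Q\in\mathcal Q$. The risk of a Borel function $\widehat x:\mathbf R^m\to\mathbf R^\nu$ is $$\mathrm{Risk}_{\mathcal Q,\|\cdot\|}[\widehat x|\mathcal X]=\sup_{x\in\mathcal X,\,P\preccurlyeq\mathcal Q}\mathbf E_{\xi\sim P}\{\|\widehat x(Ax+\xi)-Bx\|\}.$$ *)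

theory Defs
  imports "HOL-Probability.Probability" "Jordan_Normal_Form.Matrix"
begin

(* Spaces of fixed dimension (R^n, R^m, R^nu, R^q, R^K, R^L) are rendered as real^'n etc.
   The sizes d_k, f_l of the spectratope blocks depend on k, l, so matrices in S^{d_k}, S^{f_l}
   are dimension-carrying matrices (type real mat) living in the carriers carrier_mat.  Both
   matrix libraries use the same infix symbols for indexing and for the inner product; they are
   reserved here for real^'n. *)

no_notation Matrix.vec_index (infixl \<open>$\<close> 100)
no_notation Matrix.scalar_prod (infix \<open>\<bullet>\<close> 70)


definition sym_mat :: "nat \<Rightarrow> real mat \<Rightarrow> bool" where
  "sym_mat d A \<longleftrightarrow> A \<in> carrier_mat d d \<and> transpose_mat A = A"

definition psd_mat :: "nat \<Rightarrow> real mat \<Rightarrow> bool" where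
  "psd_mat d A \<longleftrightarrow> sym_mat d A \<and> (\<forall>v \<in> carrier_vec d. 0 \<le> scalar_prod v (A *\<^sub>v v))"

definition tr_mat :: "real mat \<Rightarrow> real" where
  "tr_mat A = (\<Sum>a<dim_row A. A $$ (a, a))"

definition psd :: "real^'n^'n \<Rightarrow> bool" where
  "psd A \<longleftrightarrow> transpose A = A \<and> (\<forall>x. 0 \<le> x \<bullet> (A *v x))"

definition pos_def :: "real^'n^'n \<Rightarrow> bool" where
  "pos_def A \<longleftrightarrow> transpose A = A \<and> (\<forall>x. x \<noteq> 0 \<longrightarrow> 0 < x \<bullet> (A *v x))"

definition block_matrix ::
    "real^'a^'a \<Rightarrow> real^'b^'a \<Rightarrow> real^'a^'b \<Rightarrow> real^'b^'b \<Rightarrow> real^('a + 'b)^('a + 'b)" where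
  "block_matrix P Q R S = (\<chi> i j.
     case i of
       Inl a \<Rightarrow> (case j of Inl a' \<Rightarrow> P $ a $ a' | Inr b' \<Rightarrow> Q $ a $ b')
     | Inr b \<Rightarrow> (case j of Inl a' \<Rightarrow> R $ b $ a' | Inr b' \<Rightarrow> S $ b $ b'))"


(* The order on real^'k is the entrywise one. *)
definition monotonic_set :: "(real^'k) set \<Rightarrow> bool" where
  "monotonic_set T \<longleftrightarrow>
     convex T \<and> compact T \<and> (\<forall>t\<in>T. 0 \<le> t) \<and> (\<exists>t\<in>T. \<forall>k. 0 < t $ k) \<and>
     (\<forall>t\<in>T. \<forall>t'. 0 \<le> t' \<and> t' \<le> t \<longrightarrow> t' \<in> T)"

definition lin_mat :: "nat \<Rightarrow> ('n::finite \<Rightarrow> real mat) \<Rightarrow> real^'n \<Rightarrow> real mat" where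
  "lin_mat d F x = Matrix.mat d d (\<lambda>(a, b). \<Sum>i\<in>UNIV. x $ i * F i $$ (a, b))"

definition spectratope_data ::
    "('k::finite \<Rightarrow> nat) \<Rightarrow> (real^'k) set \<Rightarrow> ('k \<Rightarrow> 'n::finite \<Rightarrow> real mat) \<Rightarrow> bool" where
  "spectratope_data d T R \<longleftrightarrow>
     monotonic_set T \<and> (\<forall>k i. sym_mat (d k) (R k i)) \<and>
     (\<forall>x. x \<noteq> 0 \<longrightarrow> (\<exists>k. lin_mat (d k) (R k) x \<noteq> 0\<^sub>m (d k) (d k)))"

definition basic_spectratope ::
    "('k::finite \<Rightarrow> nat) \<Rightarrow> (real^'k) set \<Rightarrow> ('k \<Rightarrow> 'n::finite \<Rightarrow> real mat) \<Rightarrow> (real^'n) set" where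
  "basic_spectratope d T R = {x. \<exists>t\<in>T. \<forall>k.
     psd_mat (d k) (t $ k \<cdot>\<^sub>m 1\<^sub>m (d k) - lin_mat (d k) (R k) x * lin_mat (d k) (R k) x)}"

definition adj_map :: "('n::finite \<Rightarrow> real mat) \<Rightarrow> real mat \<Rightarrow> real^'n^'n" where
  "adj_map F Z = (\<chi> i j. 1/2 * tr_mat (Z * (F i * F j + F j * F i)))"

definition trace_vec :: "('k::finite \<Rightarrow> real mat) \<Rightarrow> real^'k" where
  "trace_vec Z = (\<chi> k. tr_mat (Z k))"

definition support_fun :: "(real^'k) set \<Rightarrow> real^'k \<Rightarrow> real" where
  "support_fun T g = (SUP t\<in>T. g \<bullet> t)"

definition Gamma_fun :: "(real^'m^'m) set \<Rightarrow> real^'m^'m \<Rightarrow> real" where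
  "Gamma_fun \<Q> \<Theta> = (SUP Q\<in>\<Q>. trace (Q ** \<Theta>))"


definition is_norm :: "(real^'v \<Rightarrow> real) \<Rightarrow> bool" where
  "is_norm N \<longleftrightarrow> (\<forall>u. 0 \<le> N u) \<and> (\<forall>u. N u = 0 \<longleftrightarrow> u = 0) \<and>
     (\<forall>c u. N (c *\<^sub>R u) = \<bar>c\<bar> * N u) \<and> (\<forall>u v. N (u + v) \<le> N u + N v)"

definition conj_norm :: "(real^'v \<Rightarrow> real) \<Rightarrow> real^'v \<Rightarrow> real" where
  "conj_norm N z = (SUP u\<in>{u. N u \<le> 1}. z \<bullet> u)"


(* Integrability of all products is part of the definition: the Bochner integral of a
   non-integrable function is 0, whereas such a P has no finite second-moment matrix. *)
definition cov_dominated :: "(real^'m) measure \<Rightarrow> (real^'m^'m) set \<Rightarrow> bool" where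
  "cov_dominated P \<Q> \<longleftrightarrow>
     (\<forall>i j. integrable P (\<lambda>\<xi>. \<xi> $ i * \<xi> $ j)) \<and>
     (\<exists>Q\<in>\<Q>. psd (Q - (\<chi> i j. \<integral>\<xi>. \<xi> $ i * \<xi> $ j \<partial>P)))"

definition risk ::
    "real^'n^'m \<Rightarrow> real^'n^'v \<Rightarrow> (real^'v \<Rightarrow> real) \<Rightarrow> (real^'n) set \<Rightarrow> (real^'m^'m) set \<Rightarrow>
     (real^'m \<Rightarrow> real^'v) \<Rightarrow> ennreal" where
  "risk A B N X \<Q> xhat =
     (SUP x\<in>X. SUP P\<in>{P. prob_space P \<and> sets P = sets borel \<and> cov_dominated P \<Q>}.
        \<integral>\<^sup>+ \<xi>. ennreal (N (xhat (A *v x + \<xi>) - B *v x)) \<partial>P)"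


type_synonym ('v, 'm, 'k, 'l) sol =
  "(real^'v^'m) \<times> ('k \<Rightarrow> real mat) \<times> ('l \<Rightarrow> real mat) \<times> ('l \<Rightarrow> real mat) \<times> (real^'m^'m)"

definition feasible ::
    "real^'n^'m \<Rightarrow> real^'n^'v \<Rightarrow> real^'q^'v \<Rightarrow>
     ('k::finite \<Rightarrow> nat) \<Rightarrow> ('k \<Rightarrow> 'n \<Rightarrow> real mat) \<Rightarrow> ('l::finite \<Rightarrow> nat) \<Rightarrow> ('l \<Rightarrow> 'q \<Rightarrow> real mat) \<Rightarrow>
     ('v, 'm, 'k, 'l) sol \<Rightarrow> bool" where
  "feasible A B M d R f S = (\<lambda>(H, \<Lambda>, \<Upsilon>, \<Upsilon>', \<Theta>).
     (\<forall>k. psd_mat (d k) (\<Lambda> k)) \<and> (\<forall>l. psd_mat (f l) (\<Upsilon> l)) \<and> (\<forall>l. psd_mat (f l) (\<Upsilon>' l)) \<and>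
     transpose \<Theta> = \<Theta> \<and>
     psd (block_matrix
       (\<Sum>k\<in>UNIV. adj_map (R k) (\<Lambda> k))
       ((1/2) *\<^sub>R ((transpose B - transpose A ** H) ** M))
       ((1/2) *\<^sub>R (transpose M ** (B - transpose H ** A)))
       (\<Sum>l\<in>UNIV. adj_map (S l) (\<Upsilon> l))) \<and>
     psd (block_matrix
       \<Theta>
       ((1/2) *\<^sub>R (H ** M))
       ((1/2) *\<^sub>R (transpose M ** transpose H))
       (\<Sum>l\<in>UNIV. adj_map (S l) (\<Upsilon>' l))))"

definition objective ::
    "(real^'k) set \<Rightarrow> (real^'l) set \<Rightarrow> (real^'m^'m) set \<Rightarrow>
     ('v, 'm, 'k, 'l) sol \<Rightarrow> real" where
  "objective T \<R> \<Q> = (\<lambda>(H, \<Lambda>, \<Upsilon>, \<Upsilon>', \<Theta>).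
     support_fun T (trace_vec \<Lambda>) + support_fun \<R> (trace_vec \<Upsilon>) + support_fun \<R> (trace_vec \<Upsilon>')
     + Gamma_fun \<Q> \<Theta>)"

end

theory Submission
  imports Defs
begin

text \<open>The two matrix inequalities bound the bilinear forms of (B - H^T A) x against M y and of
  H^T xi against M y by quadratic forms in x, y and xi. On the spectratopes the forms in x and y are
  at most the values of the support functions, because Tr(Lambda_k R_k[x]^2) is at most
  t_k Tr(Lambda_k), and the expectation of the form in xi is at most Gamma(Theta). Since the norm is
  the support function of the image of the spectratope under M, the risk bound follows.
  The minimum is attained because sublevel sets are compact: the objective controls the traces of
  Lambda, Upsilon, Upsilon' and, the matrices in Q being positive definite, that of Theta; the
  second matrix inequality then controls H M, and hence H because M is surjective.\<close>

section \<open>Sums over positive semidefinite arrays\<close>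

lemma sum_insert_insert:
  fixes F :: "'i \<Rightarrow> 'i \<Rightarrow> real"
  assumes "finite J" "p \<notin> J"
  shows "(\<Sum>a\<in>insert p J. \<Sum>b\<in>insert p J. F a b) =
    F p p + (\<Sum>b\<in>J. F p b) + (\<Sum>a\<in>J. F a p) + (\<Sum>a\<in>J. \<Sum>b\<in>J. F a b)"
  using assms by (simp add: sum.distrib)

lemma psd_diagonal_nonneg:
  fixes Y :: "'i \<Rightarrow> 'i \<Rightarrow> real"
  assumes fin: "finite I" and p: "p \<in> I" and psd: "\<And>v. 0 \<le> (\<Sum>a\<in>I. \<Sum>b\<in>I. v a * v b * Y a b)"
  shows "0 \<le> Y p p"
proof -
  let ?v = "\<lambda>b. if b = p then 1 else 0 :: real"
  have "(\<Sum>a\<in>I. \<Sum>b\<in>I. ?v a * ?v b * Y a b) = (\<Sum>a\<in>{p}. \<Sum>b\<in>{p}. ?v a * ?v b * Y a b)"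
  proof (rule sum.mono_neutral_cong_right)
    show "(\<Sum>b\<in>I. ?v a * ?v b * Y a b) = (\<Sum>b\<in>{p}. ?v a * ?v b * Y a b)" for a
      by (rule sum.mono_neutral_right) (use fin p in auto)
  qed (use fin p in auto)
  then show ?thesis using psd[of ?v] by simp
qed

lemma psd_two_point_form:
  fixes Y :: "'i \<Rightarrow> 'i \<Rightarrow> real"
  assumes fin: "finite I" and I: "p \<in> I" "q \<in> I" "p \<noteq> q" and sym: "Y q p = Y p q"
    and psd: "\<And>v. 0 \<le> (\<Sum>a\<in>I. \<Sum>b\<in>I. v a * v b * Y a b)"
  shows "0 \<le> s\<^sup>2 * Y p p + 2 * s * Y p q + Y q q"
proof -
  let ?v = "\<lambda>c. if c = p then s else if c = q then 1 else 0"
  have "(\<Sum>a\<in>I. \<Sum>b\<in>I. ?v a * ?v b * Y a b) = (\<Sum>a\<in>{p,q}. \<Sum>b\<in>{p,q}. ?v a * ?v b * Y a b)"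
  proof (rule sum.mono_neutral_cong_right)
    show "(\<Sum>b\<in>I. ?v a * ?v b * Y a b) = (\<Sum>b\<in>{p,q}. ?v a * ?v b * Y a b)" for a
      by (rule sum.mono_neutral_right) (use fin I in auto)
  qed (use fin I in auto)
  also have "\<dots> = s\<^sup>2 * Y p p + 2 * s * Y p q + Y q q"
    using I(3) sym by (simp add: power2_eq_square)
  finally show ?thesis using psd[of ?v] by simp
qed

lemma psd_zero_diagonal:
  fixes Y :: "'i \<Rightarrow> 'i \<Rightarrow> real"
  assumes fin: "finite I" and I: "p \<in> I" "q \<in> I" and sym: "Y q p = Y p q"
    and psd: "\<And>v. 0 \<le> (\<Sum>a\<in>I. \<Sum>b\<in>I. v a * v b * Y a b)" and zero: "Y p p = 0"
  shows "Y p q = 0"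
proof (rule ccontr)
  assume nz: "Y p q \<noteq> 0"
  with zero have "p \<noteq> q" by auto
  note nn = psd_two_point_form[of I p q Y, OF fin I this sym psd]
  have "2 * (- (Y q q + 1) / (2 * Y p q)) * Y p q + Y q q = -1"
    using nz by (simp add: field_simps)
  then show False using nn[of "- (Y q q + 1) / (2 * Y p q)"] zero by simp
qed

lemma psd_entry_le_trace:
  fixes Y :: "'i \<Rightarrow> 'i \<Rightarrow> real"
  assumes fin: "finite I" and I: "p \<in> I" "q \<in> I" and sym: "Y q p = Y p q"
    and psd: "\<And>v. 0 \<le> (\<Sum>a\<in>I. \<Sum>b\<in>I. v a * v b * Y a b)"
  shows "\<bar>Y p q\<bar> \<le> (\<Sum>a\<in>I. Y a a)"
proof -
  have diag: "0 \<le> Y a a" if "a \<in> I" for a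
    using psd_diagonal_nonneg[of I a Y, OF fin that psd] .
  show ?thesis
  proof (cases "p = q")
    case True
    then show ?thesis
      using member_le_sum[of p I "\<lambda>a. Y a a"] fin I diag by auto
  next
    case False
    note nn = psd_two_point_form[of I p q Y, OF fin I False sym psd]
    have "Y p p + Y q q = (\<Sum>a\<in>{p,q}. Y a a)" using False by simp
    also have "\<dots> \<le> (\<Sum>a\<in>I. Y a a)" by (rule sum_mono2) (use fin I diag in auto)
    finally show ?thesis
      using nn[of 1] nn[of "-1"] diag[OF I(1)] diag[OF I(2)] by (simp add: abs_le_iff)
  qed
qed

text \<open>One step of the Cholesky decomposition of \<^term>\<open>Y\<close>: subtracting a rank one matrix leaves a
  positive semidefinite matrix that lives on a smaller index set.\<close>
lemma trace_prod_psd_nonneg: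
  fixes X Y :: "'i \<Rightarrow> 'i \<Rightarrow> real"
  assumes "finite I" and "\<And>a b. a \<in> I \<Longrightarrow> b \<in> I \<Longrightarrow> Y a b = Y b a"
    and "\<And>v. 0 \<le> (\<Sum>a\<in>I. \<Sum>b\<in>I. v a * v b * X a b)"
    and "\<And>v. 0 \<le> (\<Sum>a\<in>I. \<Sum>b\<in>I. v a * v b * Y a b)"
  shows "0 \<le> (\<Sum>a\<in>I. \<Sum>b\<in>I. X a b * Y a b)"
  using assms
proof (induction I arbitrary: Y rule: finite_induct)
  case (insert p J)
  note sym = insert.prems(1) and X = insert.prems(2) and Y = insert.prems(3)
  note split = sum_insert_insert[OF insert.hyps]
  define y where "y = Y p p"
  define Y' where "Y' a b = Y a b - Y a p * Y p b / y" for a b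
  have sub: "(\<Sum>a\<in>J. \<Sum>b\<in>J. (v(p := 0)) a * (v(p := 0)) b * Z a b) = (\<Sum>a\<in>J. \<Sum>b\<in>J. v a * v b * Z a b)"
    for v :: "'i \<Rightarrow> real" and Z :: "'i \<Rightarrow> 'i \<Rightarrow> real"
    using insert.hyps by (intro sum.cong refl) auto
  have y0: "0 \<le> y"
    using Y[of "(\<lambda>_. 0)(p := 1)"] insert.hyps unfolding split
    by (simp add: y_def sum.neutral split: if_splits cong: sum.cong)
  have zero: "Y p b = 0" if "y = 0" "b \<in> J" for b
    by (rule psd_zero_diagonal[of "insert p J"]) (use insert that sym Y in \<open>auto simp: y_def\<close>)
  have XJ: "0 \<le> (\<Sum>a\<in>J. \<Sum>b\<in>J. v a * v b * X a b)" for v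
    using X[of "v(p := 0)"] unfolding split sub by simp
  have YJ: "0 \<le> (\<Sum>a\<in>J. \<Sum>b\<in>J. v a * v b * Y' a b)" for v
  proof -
    define s where "s = (\<Sum>b\<in>J. v b * Y p b)"
    have s': "(\<Sum>a\<in>J. v a * Y a p) = s"
      unfolding s_def using sym by (intro sum.cong) auto
    define w where "w = v(p := - s / y)"
    have wJ: "w a = v a" if "a \<in> J" for a using that insert.hyps by (auto simp: w_def)
    have "(\<Sum>a\<in>J. \<Sum>b\<in>J. v a * v b * Y' a b) =
      (\<Sum>a\<in>J. \<Sum>b\<in>J. v a * v b * Y a b) - (\<Sum>a\<in>J. \<Sum>b\<in>J. (v a * Y a p) * (v b * Y p b)) / y"
      unfolding Y'_def sum_divide_distrib sum_subtractf[symmetric]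
      by (intro sum.cong refl) (simp add: algebra_simps)
    also have "\<dots> = (\<Sum>a\<in>J. \<Sum>b\<in>J. v a * v b * Y a b) - s * s / y"
      unfolding sum_product[symmetric] s' s_def[symmetric] ..
    also have "\<dots> = (\<Sum>a\<in>insert p J. \<Sum>b\<in>insert p J. w a * w b * Y a b)"
    proof -
      have 1: "(\<Sum>b\<in>J. w p * w b * Y p b) = w p * s"
        unfolding s_def sum_distrib_left by (intro sum.cong refl) (simp add: wJ)
      have 2: "(\<Sum>a\<in>J. w a * w p * Y a p) = w p * s"
        unfolding s'[symmetric] sum_distrib_left by (intro sum.cong refl) (simp add: wJ)
      have 3: "(\<Sum>a\<in>J. \<Sum>b\<in>J. w a * w b * Y a b) = (\<Sum>a\<in>J. \<Sum>b\<in>J. v a * v b * Y a b)"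
        by (intro sum.cong refl) (simp add: wJ)
      have "w p * w p * y + 2 * (w p * s) = - (s * s / y)"
        unfolding w_def by (cases "y = 0") (auto simp: field_simps)
      then show ?thesis unfolding split 1 2 3 y_def[symmetric] by linarith
    qed
    finally show ?thesis using Y[of w] by simp
  qed
  have IH: "0 \<le> (\<Sum>a\<in>J. \<Sum>b\<in>J. X a b * Y' a b)"
    by (rule insert.IH[OF _ XJ YJ]) (use sym in \<open>auto simp: Y'_def\<close>)
  define v where "v a = Y a p" for a
  have vs: "Y p b = v b" if "b \<in> J" for b using sym that by (auto simp: v_def)
  have sum_eq: "(\<Sum>a\<in>J. \<Sum>b\<in>J. X a b * Y a b) =
     (\<Sum>a\<in>J. \<Sum>b\<in>J. X a b * Y' a b) + (\<Sum>a\<in>J. \<Sum>b\<in>J. v a * v b * X a b) / y"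
    unfolding Y'_def sum_divide_distrib sum.distrib[symmetric] v_def[symmetric]
    by (intro sum.cong refl) (simp add: algebra_simps vs)
  show ?case
  proof (cases "y = 0")
    case True
    have "(\<Sum>b\<in>J. X p b * Y p b) = 0" "(\<Sum>a\<in>J. X a p * Y a p) = 0"
      using zero[OF True] sym by (auto intro!: sum.neutral)
    then show ?thesis unfolding split using IH sum_eq True by (simp add: y_def)
  next
    case False
    have "(\<Sum>a\<in>insert p J. \<Sum>b\<in>insert p J. v a * v b * X a b) / y =
      X p p * y + (\<Sum>b\<in>J. X p b * Y p b) + (\<Sum>a\<in>J. X a p * Y a p)
        + (\<Sum>a\<in>J. \<Sum>b\<in>J. v a * v b * X a b) / y"
    proof -
      have 1: "(\<Sum>b\<in>J. v p * v b * X p b) = y * (\<Sum>b\<in>J. X p b * Y p b)"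
        unfolding sum_distrib_left by (intro sum.cong refl) (simp add: vs v_def y_def)
      have 2: "(\<Sum>b\<in>J. v b * v p * X b p) = y * (\<Sum>b\<in>J. X b p * Y b p)"
        unfolding sum_distrib_left by (intro sum.cong refl) (simp add: v_def y_def)
      have "v p = y" by (simp add: v_def y_def)
      then show ?thesis unfolding split 1 2 using False by (simp add: field_simps)
    qed
    moreover have "0 \<le> (\<Sum>a\<in>insert p J. \<Sum>b\<in>insert p J. v a * v b * X a b) / y"
      by (rule divide_nonneg_nonneg[OF X y0])
    ultimately show ?thesis unfolding split sum_eq using IH by (simp add: y_def)
  qed
qed simp


section \<open>The constraints as quadratic inequalities\<close>

text \<open>In the notation of the paper, this is Tr(Z F[x]^2).\<close>
definition spec_form :: "nat \<Rightarrow> ('n::finite \<Rightarrow> real mat) \<Rightarrow> real mat \<Rightarrow> real^'n \<Rightarrow> real" where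
  "spec_form d F Z x = (\<Sum>a<d. \<Sum>b<d. Z $$ (a, b) * (lin_mat d F x * lin_mat d F x) $$ (b, a))"

lemma quadratic_form_mat:
  fixes A :: "real mat"
  assumes "A \<in> carrier_mat n n" "v \<in> carrier_vec n"
  shows "scalar_prod v (A *\<^sub>v v) = (\<Sum>a<n. \<Sum>b<n. vec_index v a * vec_index v b * A $$ (a, b))"
  using assms
  by (auto simp: scalar_prod_def lessThan_atLeast0 sum_distrib_left mult.commute[of "A $$ _"]
      mult.assoc intro!: sum.cong)

lemma psd_mat_iff:
  "psd_mat n A \<longleftrightarrow> A \<in> carrier_mat n n \<and> (\<forall>a<n. \<forall>b<n. A $$ (a, b) = A $$ (b, a)) \<and>
     (\<forall>v. 0 \<le> (\<Sum>a<n. \<Sum>b<n. v a * v b * A $$ (a, b)))"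
proof (cases "A \<in> carrier_mat n n")
  case True
  have "transpose_mat A = A \<longleftrightarrow> (\<forall>a<n. \<forall>b<n. A $$ (a, b) = A $$ (b, a))"
  proof
    assume tr: "transpose_mat A = A"
    show "\<forall>a<n. \<forall>b<n. A $$ (a, b) = A $$ (b, a)"
    proof (intro allI impI)
      fix a b assume "a < n" "b < n"
      then have "transpose_mat A $$ (a, b) = A $$ (b, a)" using True by auto
      then show "A $$ (a, b) = A $$ (b, a)" using tr by simp
    qed
  qed (use True in \<open>auto intro!: eq_matI\<close>)
  moreover have "(\<forall>v\<in>carrier_vec n. 0 \<le> scalar_prod v (A *\<^sub>v v)) \<longleftrightarrow>
     (\<forall>v. 0 \<le> (\<Sum>a<n. \<Sum>b<n. v a * v b * A $$ (a, b)))" (is "?L \<longleftrightarrow> ?R")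
  proof
    assume L: ?L
    show ?R
    proof
      fix v :: "nat \<Rightarrow> real"
      have "0 \<le> scalar_prod (Matrix.vec n v) (A *\<^sub>v Matrix.vec n v)" using L by simp
      then show "0 \<le> (\<Sum>a<n. \<Sum>b<n. v a * v b * A $$ (a, b))"
        using quadratic_form_mat[OF True, of "Matrix.vec n v"] by simp
    qed
  next
    assume ?R then show ?L by (simp add: quadratic_form_mat[OF True])
  qed
  ultimately show ?thesis using True by (simp add: psd_mat_def sym_mat_def)
qed (auto simp: psd_mat_def sym_mat_def)

lemma tr_mat_psd_nonneg: "psd_mat n A \<Longrightarrow> 0 \<le> tr_mat A"
  using psd_diagonal_nonneg[of "{..<n}" _ "\<lambda>a b. A $$ (a, b)"]
  by (auto simp: tr_mat_def psd_mat_iff intro!: sum_nonneg)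

lemma psd_mat_entry_bound:
  assumes "psd_mat n A" "a < n" "b < n" shows "\<bar>A $$ (a, b)\<bar> \<le> tr_mat A"
  using psd_entry_le_trace[of "{..<n}" a b "\<lambda>a b. A $$ (a, b)"] assms
  by (auto simp: tr_mat_def psd_mat_iff)

lemma lin_mat_carrier [simp]: "lin_mat d F x \<in> carrier_mat d d"
  "dim_row (lin_mat d F x) = d" "dim_col (lin_mat d F x) = d"
  by (simp_all add: lin_mat_def)

lemma lin_mat_index: "a < d \<Longrightarrow> b < d \<Longrightarrow> lin_mat d F x $$ (a, b) = (\<Sum>i\<in>UNIV. x $ i * F i $$ (a, b))"
  by (simp add: lin_mat_def)

lemma mat_mult_index:
  "A \<in> carrier_mat d d \<Longrightarrow> B \<in> carrier_mat d d \<Longrightarrow> a < d \<Longrightarrow> b < d \<Longrightarrow>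
    (A * B) $$ (a, b) = (\<Sum>c<d. A $$ (a, c) * B $$ (c, b))"
  by (auto simp: scalar_prod_def lessThan_atLeast0 intro!: sum.cong)

lemma tr_mat_mult:
  assumes "A \<in> carrier_mat d d" "B \<in> carrier_mat d d"
  shows "tr_mat (A * B) = (\<Sum>a<d. \<Sum>b<d. A $$ (a, b) * B $$ (b, a))"
  using assms by (auto simp: tr_mat_def mat_mult_index[OF assms] simp del: index_mult_mat(1) intro!: sum.cong)

lemma sum_swap_triple:
  "(\<Sum>i\<in>A. \<Sum>j\<in>B. \<Sum>a\<in>C. h i j a) = (\<Sum>a\<in>C. \<Sum>i\<in>A. \<Sum>j\<in>B. h i j a)"
  for h :: "_ \<Rightarrow> _ \<Rightarrow> _ \<Rightarrow> 'z::comm_monoid_add"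
proof -
  have "(\<Sum>i\<in>A. \<Sum>j\<in>B. \<Sum>a\<in>C. h i j a) = (\<Sum>i\<in>A. \<Sum>a\<in>C. \<Sum>j\<in>B. h i j a)"
    by (rule sum.cong[OF refl], rule sum.swap)
  also have "\<dots> = (\<Sum>a\<in>C. \<Sum>i\<in>A. \<Sum>j\<in>B. h i j a)"
    by (rule sum.swap)
  finally show ?thesis .
qed

lemma adj_map_form:
  assumes F: "\<And>i. F i \<in> carrier_mat d d" and Z: "Z \<in> carrier_mat d d"
  shows "x \<bullet> (adj_map F Z *v x) = spec_form d F Z x"
proof -
  define t where "t i j = (\<Sum>a<d. \<Sum>b<d. Z $$ (a, b) * (\<Sum>c<d. F i $$ (b, c) * F j $$ (c, a)))" for i j
  have "tr_mat (Z * (F i * F j + F j * F i)) = t i j + t j i" for i j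
  proof -
    have [simp]: "F i * F j \<in> carrier_mat d d" "F j * F i \<in> carrier_mat d d"
      by (rule mult_carrier_mat[OF F F])+
    have "(F i * F j + F j * F i) $$ (b, a)
      = (\<Sum>c<d. F i $$ (b, c) * F j $$ (c, a)) + (\<Sum>c<d. F j $$ (b, c) * F i $$ (c, a))"
      if "a < d" "b < d" for a b
      using that F[of i] F[of j] by (simp add: mat_mult_index[of _ d] del: index_mult_mat(1))
    then show ?thesis
      unfolding t_def by (subst tr_mat_mult[OF Z]) (simp_all add: sum.distrib distrib_left)
  qed
  then have "x \<bullet> (adj_map F Z *v x) = (\<Sum>i\<in>UNIV. \<Sum>j\<in>UNIV. x $ i * x $ j * (t i j + t j i) / 2)"
    by (auto simp: inner_vec_def matrix_vector_mult_def adj_map_def sum_distrib_left intro!: sum.cong)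
  also have "\<dots> = (\<Sum>i\<in>UNIV. \<Sum>j\<in>UNIV. x $ i * x $ j * t i j) / 2 + (\<Sum>i\<in>UNIV. \<Sum>j\<in>UNIV. x $ i * x $ j * t j i) / 2"
    unfolding sum_divide_distrib sum.distrib[symmetric] by (simp add: field_simps)
  also have "(\<Sum>i\<in>UNIV. \<Sum>j\<in>UNIV. x $ i * x $ j * t j i) = (\<Sum>i\<in>UNIV. \<Sum>j\<in>UNIV. x $ i * x $ j * t i j)"
    by (subst sum.swap) (simp add: ac_simps)
  finally have "x \<bullet> (adj_map F Z *v x) = (\<Sum>i\<in>UNIV. \<Sum>j\<in>UNIV. x $ i * x $ j * t i j)"
    by simp
  also have "\<dots> = (\<Sum>i\<in>UNIV. \<Sum>j\<in>UNIV. \<Sum>a<d. \<Sum>b<d. \<Sum>c<d.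
      Z $$ (a, b) * ((x $ i * F i $$ (b, c)) * (x $ j * F j $$ (c, a))))"
    unfolding t_def sum_distrib_left by (simp add: ac_simps)
  also have "\<dots> = (\<Sum>a<d. \<Sum>b<d. \<Sum>c<d. \<Sum>i\<in>UNIV. \<Sum>j\<in>UNIV.
      Z $$ (a, b) * ((x $ i * F i $$ (b, c)) * (x $ j * F j $$ (c, a))))"
    by (rule trans[OF sum_swap_triple], rule sum.cong[OF refl],
        rule trans[OF sum_swap_triple], rule sum.cong[OF refl], rule sum_swap_triple)
  also have "\<dots> = spec_form d F Z x"
  proof -
    have "(lin_mat d F x * lin_mat d F x) $$ (b, a)
      = (\<Sum>c<d. \<Sum>i\<in>UNIV. \<Sum>j\<in>UNIV. (x $ i * F i $$ (b, c)) * (x $ j * F j $$ (c, a)))"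
      if "a < d" "b < d" for a b
      unfolding sum_product[symmetric]
      using that by (simp add: mat_mult_index[of _ d] lin_mat_index del: index_mult_mat(1))
    then show ?thesis
      unfolding spec_form_def by (intro sum.cong refl) (simp add: sum_distrib_left)
  qed
  finally show ?thesis .
qed

lemma adj_map_symmetric:
  assumes F: "\<And>i. F i \<in> carrier_mat d d"
  shows "transpose (adj_map F Z) = adj_map F Z"
proof -
  have "F i * F j + F j * F i = F j * F i + F i * F j" for i j
    by (rule comm_add_mat[where nr=d and nc=d]) (rule mult_carrier_mat[OF F F])+
  then show ?thesis by (simp add: adj_map_def transpose_def Finite_Cartesian_Product.vec_eq_iff)
qed

lemma sum_UNIV_sum_type:
  "(\<Sum>i\<in>UNIV. g i) = (\<Sum>a\<in>UNIV. g (Inl a)) + (\<Sum>b\<in>UNIV. g (Inr b))"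
  for g :: "'a::finite + 'b::finite \<Rightarrow> 'c::comm_monoid_add"
  by (metis UNIV_Plus_UNIV comp_apply finite sum.Plus sum.cong)

lemma psd_block_matrix_iff:
  fixes P :: "real^'a^'a" and S :: "real^'b^'b"
  assumes P: "transpose P = P" and S: "transpose S = S" and Q: "Q' = transpose Q"
  shows "psd (block_matrix P Q Q' S) \<longleftrightarrow>
    (\<forall>x y. 0 \<le> x \<bullet> (P *v x) + 2 * (x \<bullet> (Q *v y)) + y \<bullet> (S *v y))"
proof -
  have P': "P $ i $ j = P $ j $ i" for i j using P by (metis transpose_def vec_lambda_beta)
  have S': "S $ i $ j = S $ j $ i" for i j using S by (metis transpose_def vec_lambda_beta)
  have form: "z \<bullet> (block_matrix P Q Q' S *v z) = x \<bullet> (P *v x) + 2 * (x \<bullet> (Q *v y)) + y \<bullet> (S *v y)"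
    if "x = (\<chi> a. z $ Inl a)" "y = (\<chi> b. z $ Inr b)" for x y z
  proof -
    have zi: "z $ Inl a = x $ a" "z $ Inr b = y $ b" for a b using that by auto
    have bi: "block_matrix P Q Q' S $ Inl a $ Inl a' = P $ a $ a'"
      "block_matrix P Q Q' S $ Inl a $ Inr b = Q $ a $ b"
      "block_matrix P Q Q' S $ Inr b $ Inl a = Q $ a $ b"
      "block_matrix P Q Q' S $ Inr b $ Inr b' = S $ b $ b'" for a a' b b'
      by (simp_all add: block_matrix_def Q transpose_def)
    have "z \<bullet> (block_matrix P Q Q' S *v z) = (\<Sum>a\<in>UNIV. x $ a * ((\<Sum>a'\<in>UNIV. P $ a $ a' * x $ a') + (\<Sum>b\<in>UNIV. Q $ a $ b * y $ b)))
      + (\<Sum>b\<in>UNIV. y $ b * ((\<Sum>a\<in>UNIV. Q $ a $ b * x $ a) + (\<Sum>b'\<in>UNIV. S $ b $ b' * y $ b')))"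
      unfolding inner_vec_def matrix_vector_mult_def sum_UNIV_sum_type
      by (simp add: zi bi)
    also have "\<dots> = x \<bullet> (P *v x) + x \<bullet> (Q *v y) + (\<Sum>b\<in>UNIV. \<Sum>a\<in>UNIV. y $ b * (Q $ a $ b * x $ a)) + y \<bullet> (S *v y)"
      by (simp add: inner_vec_def matrix_vector_mult_def distrib_left sum.distrib sum_distrib_left)
    also have "(\<Sum>b\<in>UNIV. \<Sum>a\<in>UNIV. y $ b * (Q $ a $ b * x $ a)) = x \<bullet> (Q *v y)"
      by (subst sum.swap) (simp add: inner_vec_def matrix_vector_mult_def sum_distrib_left ac_simps)
    finally show ?thesis by simp
  qed
  have "transpose (block_matrix P Q Q' S) = block_matrix P Q Q' S"
    by (auto simp: transpose_def block_matrix_def Finite_Cartesian_Product.vec_eq_iff Q P' S' split: sum.split)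
  moreover have "(\<forall>z. 0 \<le> z \<bullet> (block_matrix P Q Q' S *v z)) \<longleftrightarrow>
    (\<forall>x y. 0 \<le> x \<bullet> (P *v x) + 2 * (x \<bullet> (Q *v y)) + y \<bullet> (S *v y))" (is "?L \<longleftrightarrow> ?R")
  proof
    assume L: ?L
    show ?R
    proof (intro allI)
      fix x :: "real^'a" and y :: "real^'b"
      let ?z = "\<chi> i. case i of Inl a \<Rightarrow> x $ a | Inr b \<Rightarrow> y $ b"
      have "x = (\<chi> a. ?z $ Inl a)" "y = (\<chi> b. ?z $ Inr b)"
        by (simp_all add: Finite_Cartesian_Product.vec_eq_iff)
      from form[OF this] show "0 \<le> x \<bullet> (P *v x) + 2 * (x \<bullet> (Q *v y)) + y \<bullet> (S *v y)"
        using L by metis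
    qed
  next
    assume ?R then show ?L using form[OF refl refl] by simp
  qed
  ultimately show ?thesis by (simp add: psd_def)
qed

lemma transpose_sum: "transpose (\<Sum>k\<in>K. F k) = (\<Sum>k\<in>K. transpose (F k))"
  by (induction K rule: infinite_finite_induct) (auto simp: transpose_def Finite_Cartesian_Product.vec_eq_iff)

lemma inner_transpose: "x \<bullet> (A *v y) = (transpose A *v x) \<bullet> y" for A :: "real^'n^'m"
  by (simp add: dot_lmul_matrix transpose_matrix_vector)

lemma sum_matrix_vector_mult: "(\<Sum>k\<in>K. F k) *v x = (\<Sum>k\<in>K. F k *v x)" for F :: "'k \<Rightarrow> real^'n^'m"
  by (induction K rule: infinite_finite_induct) (auto simp: matrix_vector_mult_add_rdistrib)

lemma feasible_iff:
  assumes R: "\<And>k i. R k i \<in> carrier_mat (d k) (d k)" and S: "\<And>l i. S l i \<in> carrier_mat (f l) (f l)"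
  shows "feasible A B M d R f S (H, \<Lambda>, \<Upsilon>, \<Upsilon>', \<Theta>) \<longleftrightarrow>
     (\<forall>k. psd_mat (d k) (\<Lambda> k)) \<and> (\<forall>l. psd_mat (f l) (\<Upsilon> l)) \<and> (\<forall>l. psd_mat (f l) (\<Upsilon>' l)) \<and>
     transpose \<Theta> = \<Theta> \<and>
     (\<forall>x y. 0 \<le> (\<Sum>k\<in>UNIV. spec_form (d k) (R k) (\<Lambda> k) x)
        + (B *v x - transpose H *v (A *v x)) \<bullet> (M *v y) + (\<Sum>l\<in>UNIV. spec_form (f l) (S l) (\<Upsilon> l) y)) \<and>
     (\<forall>\<xi> y. 0 \<le> \<xi> \<bullet> (\<Theta> *v \<xi>) + \<xi> \<bullet> (H *v (M *v y)) + (\<Sum>l\<in>UNIV. spec_form (f l) (S l) (\<Upsilon>' l) y))"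
proof -
  have form: "x \<bullet> ((\<Sum>k\<in>UNIV. adj_map (F k) (Z k)) *v x) = (\<Sum>k\<in>UNIV. spec_form (n k) (F k) (Z k) x)"
    if "\<And>k. psd_mat (n k) (Z k)" "\<And>k i. F k i \<in> carrier_mat (n k) (n k)"
    for F :: "'x::finite \<Rightarrow> 'y::finite \<Rightarrow> real mat" and Z n x
    unfolding sum_matrix_vector_mult inner_sum_right
    by (intro sum.cong refl adj_map_form) (use that in \<open>auto simp: psd_mat_iff\<close>)
  have sR: "transpose (\<Sum>k\<in>UNIV. adj_map (R k) (\<Lambda> k)) = (\<Sum>k\<in>UNIV. adj_map (R k) (\<Lambda> k))"
    unfolding transpose_sum using adj_map_symmetric[of "R _", OF R] by simp
  have sS: "transpose (\<Sum>l\<in>UNIV. adj_map (S l) (Z l)) = (\<Sum>l\<in>UNIV. adj_map (S l) (Z l))" for Z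
    unfolding transpose_sum using adj_map_symmetric[of "S _", OF S] by simp
  have t1: "(1/2) *\<^sub>R (transpose M ** (B - transpose H ** A))
      = transpose ((1/2) *\<^sub>R ((transpose B - transpose A ** H) ** M))"
  proof -
    have "transpose B - transpose A ** H = transpose (B - transpose H ** A)"
      using matrix_transpose_mul[of "transpose H" A] by (simp add: transpose_def Finite_Cartesian_Product.vec_eq_iff)
    then have "(transpose B - transpose A ** H) ** M = transpose (transpose M ** (B - transpose H ** A))"
      by (simp add: matrix_transpose_mul)
    then show ?thesis by (simp add: transpose_def Finite_Cartesian_Product.vec_eq_iff)
  qed
  have t2: "(1/2) *\<^sub>R (transpose M ** transpose H) = transpose ((1/2) *\<^sub>R (H ** M))"
    using matrix_transpose_mul[of H M] by (simp add: transpose_def Finite_Cartesian_Product.vec_eq_iff)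
  have c1: "2 * (x \<bullet> (((1/2) *\<^sub>R ((transpose B - transpose A ** H) ** M)) *v y))
     = (B *v x - transpose H *v (A *v x)) \<bullet> (M *v y)" for x y
    by (simp add: scaleR_matrix_vector_assoc[symmetric] matrix_vector_mul_assoc[symmetric]
        matrix_vector_mult_diff_rdistrib inner_diff_left inner_diff_right inner_transpose[of x "transpose _"]
        transpose_transpose inner_transpose[of "A *v x" H] del: transpose_matrix_vector)
  have c2: "2 * (\<xi> \<bullet> (((1/2) *\<^sub>R (H ** M)) *v y)) = \<xi> \<bullet> (H *v (M *v y))" for \<xi> y
    by (simp add: scaleR_matrix_vector_assoc[symmetric] matrix_vector_mul_assoc[symmetric])
  have c: "(psd (block_matrix
       (\<Sum>k\<in>UNIV. adj_map (R k) (\<Lambda> k))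
       ((1/2) *\<^sub>R ((transpose B - transpose A ** H) ** M))
       ((1/2) *\<^sub>R (transpose M ** (B - transpose H ** A)))
       (\<Sum>l\<in>UNIV. adj_map (S l) (\<Upsilon> l)))) \<longleftrightarrow>
     (\<forall>x y. 0 \<le> (\<Sum>k\<in>UNIV. spec_form (d k) (R k) (\<Lambda> k) x)
        + (B *v x - transpose H *v (A *v x)) \<bullet> (M *v y) + (\<Sum>l\<in>UNIV. spec_form (f l) (S l) (\<Upsilon> l) y))"
    if "\<forall>k. psd_mat (d k) (\<Lambda> k)" "\<forall>l. psd_mat (f l) (\<Upsilon> l)"
    unfolding psd_block_matrix_iff[OF sR sS t1] c1
    using that by (simp only: form[of d \<Lambda> R] form[of f \<Upsilon> S] R S)
  have c': "(psd (block_matrix \<Theta> ((1/2) *\<^sub>R (H ** M)) ((1/2) *\<^sub>R (transpose M ** transpose H))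
       (\<Sum>l\<in>UNIV. adj_map (S l) (\<Upsilon>' l)))) \<longleftrightarrow>
     (\<forall>\<xi> y. 0 \<le> \<xi> \<bullet> (\<Theta> *v \<xi>) + \<xi> \<bullet> (H *v (M *v y)) + (\<Sum>l\<in>UNIV. spec_form (f l) (S l) (\<Upsilon>' l) y))"
    if "transpose \<Theta> = \<Theta>" "\<forall>l. psd_mat (f l) (\<Upsilon>' l)"
    unfolding psd_block_matrix_iff[OF that(1) sS t2] c2
    using that by (simp only: form[of f \<Upsilon>' S] S)
  show ?thesis
    unfolding feasible_def prod.case by (intro conj_cong c c' refl) assumption+
qed


section \<open>Norm duality and support functions\<close>

lemma pos_homogeneous_lower_bound:
  fixes q :: "'a::euclidean_space \<Rightarrow> real"
  assumes cont: "continuous_on UNIV q" and pos: "\<And>x. x \<noteq> 0 \<Longrightarrow> 0 < q x"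
    and hom: "\<And>c x. q (c *\<^sub>R x) = \<bar>c\<bar> ^ p * q x" and p: "0 < p"
  obtains \<epsilon> where "0 < \<epsilon>" "\<And>x. \<epsilon> * norm x ^ p \<le> q x"
proof -
  have "sphere (0::'a) 1 \<noteq> {}" by simp
  then obtain x0 where x0: "norm x0 = 1" "\<And>x. norm x = 1 \<Longrightarrow> q x0 \<le> q x"
    using continuous_attains_inf[of "sphere 0 1" q] continuous_on_subset[OF cont] by auto
  have "q x0 * norm x ^ p \<le> q x" for x
  proof (cases "x = 0")
    case True
    have "q 0 = 0" using hom[of 0 0] p by (simp add: power_0_left)
    then show ?thesis using True p by (simp add: power_0_left)
  next
    case False
    then have "q x0 \<le> q ((1 / norm x) *\<^sub>R x)" by (intro x0) simp
    also have "\<dots> = q x / norm x ^ p" unfolding hom by (simp add: power_divide)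
    finally show ?thesis using False by (simp add: field_simps)
  qed
  moreover have "0 < q x0" using pos[of x0] x0(1) by fastforce
  ultimately show ?thesis using that by blast
qed

lemma is_norm_zero: "is_norm N \<Longrightarrow> N 0 = 0"
  by (simp add: is_norm_def)

lemma is_norm_sum_le: "is_norm N \<Longrightarrow> N (\<Sum>i\<in>I. u i) \<le> (\<Sum>i\<in>I. N (u i))"
proof (induction I rule: infinite_finite_induct)
  case (insert i I)
  then show ?case using insert.hyps unfolding is_norm_def
    by (simp, metis (no_types, lifting) add_left_mono order.trans)
qed (auto simp: is_norm_zero)

lemma is_norm_continuous:
  assumes N: "is_norm N" shows "continuous_on UNIV N"
proof -
  define C where "C = (\<Sum>i\<in>UNIV. N (axis i 1))"
  have nn: "0 \<le> N u" for u using N by (simp add: is_norm_def)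
  have scale: "N (c *\<^sub>R u) = \<bar>c\<bar> * N u" for c u using N by (simp add: is_norm_def)
  have tri: "N (u + v) \<le> N u + N v" for u v using N by (simp add: is_norm_def)
  have bound: "N u \<le> C * norm u" for u
  proof -
    have "N u = N (\<Sum>i\<in>UNIV. u $ i *\<^sub>R axis i 1)"
      using basis_expansion[of u] by (simp add: scalar_mult_eq_scaleR)
    also have "\<dots> \<le> (\<Sum>i\<in>UNIV. \<bar>u $ i\<bar> * N (axis i 1))"
      using is_norm_sum_le[OF N, of "\<lambda>i. u $ i *\<^sub>R axis i 1" UNIV] by (simp add: scale)
    also have "\<dots> \<le> (\<Sum>i\<in>UNIV. norm u * N (axis i 1))"
      by (intro sum_mono mult_right_mono component_le_norm_cart nn)
    finally show ?thesis by (simp add: C_def sum_distrib_left mult.commute)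
  qed
  have lip: "\<bar>N u - N v\<bar> \<le> C * norm (u - v)" for u v
  proof -
    have "N (v - u) = N (u - v)" using scale[of "-1" "u - v"] by simp
    then show ?thesis using tri[of "u - v" v] tri[of "v - u" u] bound[of "u - v"] by (simp add: abs_le_iff)
  qed
  have "C-lipschitz_on UNIV N"
    by (rule lipschitz_onI) (use lip nn in \<open>auto simp: dist_norm dist_real_def C_def intro!: sum_nonneg\<close>)
  then show ?thesis by (rule lipschitz_on_continuous_on)
qed

lemma is_norm_lower_bound:
  assumes N: "is_norm N" obtains c where "0 < c" "\<And>u. c * norm u \<le> N u"
  by (rule pos_homogeneous_lower_bound[of N 1])
    (use is_norm_continuous[OF N] N in \<open>auto simp: is_norm_def less_le\<close>)

lemma conj_norm_le:
  assumes N: "is_norm N" and z: "\<And>w. N w \<le> 1 \<Longrightarrow> z \<bullet> w \<le> c" shows "conj_norm N z \<le> c"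
  unfolding conj_norm_def by (rule cSUP_least) (use z is_norm_zero[OF N] in \<open>auto intro: exI[of _ 0]\<close>)

lemma norm_le_by_duality:
  assumes N: "is_norm N" and dual: "\<And>z. conj_norm N z \<le> 1 \<Longrightarrow> z \<bullet> u \<le> c"
  shows "N u \<le> c"
proof (rule ccontr)
  assume "\<not> N u \<le> c"
  then have "c < N u" by simp
  then obtain \<rho> where \<rho>: "c < \<rho>" "\<rho> < N u" using dense by blast
  have c0: "0 \<le> c" using dual[of 0] conj_norm_le[OF N, of 0 1] by simp
  let ?B = "{w. N w \<le> \<rho>}"
  have "convex ?B"
  proof (rule convexI)
    fix x y :: "real^'a" and s t :: real
    assume st: "x \<in> ?B" "y \<in> ?B" "0 \<le> s" "0 \<le> t" "s + t = 1"
    have "N (s *\<^sub>R x + t *\<^sub>R y) \<le> s * N x + t * N y"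
    proof -
      have "N (s *\<^sub>R x + t *\<^sub>R y) \<le> N (s *\<^sub>R x) + N (t *\<^sub>R y)"
        using N unfolding is_norm_def by blast
      then show ?thesis using N st(3,4) by (simp add: is_norm_def)
    qed
    also have "\<dots> \<le> s * \<rho> + t * \<rho>" using st by (intro add_mono mult_left_mono) auto
    also have "\<dots> = \<rho>" using st(5) by (simp flip: distrib_right)
    finally show "s *\<^sub>R x + t *\<^sub>R y \<in> ?B" by simp
  qed
  moreover have "closed ?B"
    using is_norm_continuous[OF N] by (intro closed_Collect_le) auto
  moreover have "u \<notin> ?B" using \<rho> by simp
  ultimately obtain a b where ab: "a \<bullet> u < b" "\<And>w. N w \<le> \<rho> \<Longrightarrow> b < a \<bullet> w"
    using separating_hyperplane_closed_point[of ?B u] by auto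
  have b: "b < 0" using ab(2)[of 0] is_norm_zero[OF N] c0 \<rho> by simp
  define z where "z = (\<rho> / b) *\<^sub>R a"
  have "conj_norm N z \<le> 1"
  proof (rule conj_norm_le[OF N])
    fix w assume "N w \<le> 1"
    then have "N (\<rho> *\<^sub>R w) \<le> \<rho>"
      using N c0 \<rho> mult_left_mono[of "N w" 1 \<rho>] by (simp add: is_norm_def)
    then have "b < \<rho> * (a \<bullet> w)" using ab(2) by fastforce
    then show "z \<bullet> w \<le> 1" using b by (simp add: z_def field_simps)
  qed
  then have "z \<bullet> u \<le> c" by (rule dual)
  moreover have "\<rho> \<le> z \<bullet> u"
  proof -
    have "\<rho> * 1 \<le> \<rho> * ((a \<bullet> u) / b)" using ab(1) b c0 \<rho>
      by (intro mult_left_mono) (auto simp: field_simps)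
    then show ?thesis by (simp add: z_def)
  qed
  ultimately show False using \<rho> by simp
qed

lemma conj_ball_image_surj:
  fixes M :: "real^'q^'v"
  assumes N: "is_norm N" and ball: "{z. conj_norm N z \<le> 1} \<subseteq> range (\<lambda>y. M *v y)"
  shows "surj (\<lambda>y. M *v y)"
proof -
  obtain c where c: "0 < c" "\<And>u. c * norm u \<le> N u" using is_norm_lower_bound[OF N] by blast
  have small: "conj_norm N z \<le> 1" if "norm z \<le> c" for z
  proof (rule conj_norm_le[OF N])
    fix w assume w: "N w \<le> 1"
    have "z \<bullet> w \<le> norm z * norm w" by (rule norm_cauchy_schwarz)
    also have "\<dots> \<le> c * norm w" using that by (simp add: mult_right_mono)
    also have "\<dots> \<le> 1" using c(2)[of w] w by simp
    finally show "z \<bullet> w \<le> 1" .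
  qed
  have "\<exists>y. z = M *v y" for z
  proof (cases "z = 0")
    case False
    have "norm ((c / norm z) *\<^sub>R z) \<le> c" using c False by simp
    then obtain y where "(c / norm z) *\<^sub>R z = M *v y" using small ball by blast
    then have "M *v ((norm z / c) *\<^sub>R y) = (norm z / c) *\<^sub>R ((c / norm z) *\<^sub>R z)"
      by (simp only: matrix_vector_mult_scaleR)
    also have "\<dots> = z" using c False by simp
    finally have "z = M *v ((norm z / c) *\<^sub>R y)" ..
    then show ?thesis by blast
  qed (auto intro: exI[of _ 0])
  then show ?thesis by (auto simp: surj_def)
qed

lemma spec_form_le:
  assumes Z: "psd_mat d Z" and W: "psd_mat d (t \<cdot>\<^sub>m 1\<^sub>m d - lin_mat d F x * lin_mat d F x)"
  shows "spec_form d F Z x \<le> t * tr_mat Z"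
proof -
  let ?L = "lin_mat d F x * lin_mat d F x"
  let ?W = "t \<cdot>\<^sub>m 1\<^sub>m d - ?L"
  have W': "?W $$ (a, b) = (if a = b then t else 0) - ?L $$ (a, b)" if "a < d" "b < d" for a b
    using that by (simp del: index_mult_mat(1))
  have "0 \<le> (\<Sum>a<d. \<Sum>b<d. Z $$ (a, b) * ?W $$ (a, b))"
    by (rule trace_prod_psd_nonneg) (use Z W in \<open>auto simp: psd_mat_iff simp del: index_mult_mat(1) index_minus_mat(1)\<close>)
  also have "\<dots> = (\<Sum>a<d. \<Sum>b<d. Z $$ (a, b) * ?W $$ (b, a))"
    using W by (intro sum.cong refl) (auto simp: psd_mat_iff simp del: index_mult_mat(1) index_minus_mat(1))
  also have "\<dots> = (\<Sum>a<d. \<Sum>b<d. (if b = a then t * Z $$ (a, a) else 0) - Z $$ (a, b) * ?L $$ (b, a))"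
    by (intro sum.cong refl) (auto simp: W' algebra_simps simp del: index_mult_mat(1) index_minus_mat(1))
  also have "\<dots> = t * tr_mat Z - spec_form d F Z x"
    using Z by (auto simp: sum_subtractf spec_form_def tr_mat_def psd_mat_iff sum_distrib_left simp del: index_mult_mat(1))
  finally show ?thesis by simp
qed

lemma spec_form_one:
  assumes F: "\<And>i. sym_mat d (F i)"
  shows "spec_form d F (\<alpha> \<cdot>\<^sub>m 1\<^sub>m d) x = \<alpha> * (\<Sum>a<d. \<Sum>c<d. (lin_mat d F x $$ (a, c))\<^sup>2)"
proof -
  have "F i $$ (c, a) = F i $$ (a, c)" if "a < d" "c < d" for i a c
    using F[of i] that unfolding sym_mat_def by (metis carrier_matD index_transpose_mat(1))
  then have sym: "lin_mat d F x $$ (c, a) = lin_mat d F x $$ (a, c)" if "a < d" "c < d" for a c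
    using that by (simp add: lin_mat_index)
  have "spec_form d F (\<alpha> \<cdot>\<^sub>m 1\<^sub>m d) x
    = (\<Sum>a<d. \<Sum>b<d. if b = a then \<alpha> * (lin_mat d F x * lin_mat d F x) $$ (a, a) else 0)"
    unfolding spec_form_def by (intro sum.cong refl) (auto simp del: index_mult_mat(1))
  also have "\<dots> = (\<Sum>a<d. \<alpha> * (lin_mat d F x * lin_mat d F x) $$ (a, a))"
    by simp
  also have "\<dots> = \<alpha> * (\<Sum>a<d. \<Sum>c<d. (lin_mat d F x $$ (a, c))\<^sup>2)"
    by (simp add: mat_mult_index[of _ d] power2_eq_square sym sum_distrib_left del: index_mult_mat(1))
  finally show ?thesis .
qed

lemma lin_mat_scale: "lin_mat d F (c *\<^sub>R x) = c \<cdot>\<^sub>m lin_mat d F x"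
  by (rule eq_matI) (auto simp: lin_mat_index sum_distrib_left mult.assoc)

lemma spec_form_scale: "spec_form d F Z (c *\<^sub>R x) = c\<^sup>2 * spec_form d F Z x"
proof -
  have "(lin_mat d F (c *\<^sub>R x) * lin_mat d F (c *\<^sub>R x)) $$ (b, a)
      = c\<^sup>2 * (lin_mat d F x * lin_mat d F x) $$ (b, a)" if "a < d" "b < d" for a b
    using that by (simp add: mat_mult_index[of _ d] lin_mat_scale power2_eq_square sum_distrib_left
        algebra_simps del: index_mult_mat(1))
  then show ?thesis unfolding spec_form_def sum_distrib_left
    by (intro sum.cong refl) (simp add: algebra_simps del: index_mult_mat(1))
qed

lemma spec_form_continuous: "continuous_on UNIV (spec_form d F Z)"
proof -
  have "spec_form d F Z = (\<lambda>x. \<Sum>a<d. \<Sum>b<d. Z $$ (a, b) *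
      (\<Sum>c<d. (\<Sum>i\<in>UNIV. x $ i * F i $$ (b, c)) * (\<Sum>i\<in>UNIV. x $ i * F i $$ (c, a))))"
    unfolding spec_form_def
    by (intro ext sum.cong refl) (simp add: mat_mult_index[of _ d] lin_mat_index del: index_mult_mat(1))
  then show ?thesis by (auto intro!: continuous_intros)
qed

lemma support_fun_upper:
  assumes "compact T" "t \<in> T" shows "g \<bullet> t \<le> support_fun T g"
proof -
  have "compact ((\<lambda>t. g \<bullet> t) ` T)"
    using assms(1) by (intro compact_continuous_image continuous_intros)
  then show ?thesis unfolding support_fun_def
    using assms(2) by (intro cSUP_upper) (auto intro: bounded_imp_bdd_above compact_imp_bounded)
qed

lemma Gamma_fun_upper:
  assumes "compact \<Q>" "Q \<in> \<Q>" shows "trace (Q ** \<Theta>) \<le> Gamma_fun \<Q> \<Theta>"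
proof -
  have "compact ((\<lambda>Q. trace (Q ** \<Theta>)) ` \<Q>)"
    using assms(1) unfolding trace_def matrix_matrix_mult_def
    by (intro compact_continuous_image) (auto intro!: continuous_intros)
  then show ?thesis unfolding Gamma_fun_def
    using assms(2) by (intro cSUP_upper) (auto intro: bounded_imp_bdd_above compact_imp_bounded)
qed

lemma objective_le_iff:
  assumes T: "compact T" "T \<noteq> {}" and R: "compact \<R>" "\<R> \<noteq> {}" and Q: "compact \<Q>" "\<Q> \<noteq> {}"
  shows "objective T \<R> \<Q> (H, \<Lambda>, \<Upsilon>, \<Upsilon>', \<Theta>) \<le> c \<longleftrightarrow>
    (\<forall>t\<in>T. \<forall>r\<in>\<R>. \<forall>r'\<in>\<R>. \<forall>Q\<in>\<Q>.
       trace_vec \<Lambda> \<bullet> t + trace_vec \<Upsilon> \<bullet> r + trace_vec \<Upsilon>' \<bullet> r' + trace (Q ** \<Theta>) \<le> c)"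
    (is "?L \<longleftrightarrow> ?R")
proof
  assume ?L
  then show ?R
    using support_fun_upper[OF T(1), of _ "trace_vec \<Lambda>"] support_fun_upper[OF R(1), of _ "trace_vec \<Upsilon>"]
      support_fun_upper[OF R(1), of _ "trace_vec \<Upsilon>'"] Gamma_fun_upper[OF Q(1), of _ \<Theta>]
    unfolding objective_def prod.case by (smt (verit))
next
  assume r: ?R
  have G: "Gamma_fun \<Q> \<Theta> \<le> c - trace_vec \<Lambda> \<bullet> t - trace_vec \<Upsilon> \<bullet> r - trace_vec \<Upsilon>' \<bullet> r'"
    if "t \<in> T" "r \<in> \<R>" "r' \<in> \<R>" for t r r'
    unfolding Gamma_fun_def by (rule cSUP_least[OF Q(2)]) (use r that in \<open>fastforce simp: algebra_simps\<close>)
  have U': "support_fun \<R> (trace_vec \<Upsilon>') \<le> c - Gamma_fun \<Q> \<Theta> - trace_vec \<Lambda> \<bullet> t - trace_vec \<Upsilon> \<bullet> r"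
    if "t \<in> T" "r \<in> \<R>" for t r
    unfolding support_fun_def by (rule cSUP_least[OF R(2)]) (use G that in fastforce)
  have U: "support_fun \<R> (trace_vec \<Upsilon>) \<le>
      c - Gamma_fun \<Q> \<Theta> - support_fun \<R> (trace_vec \<Upsilon>') - trace_vec \<Lambda> \<bullet> t" if "t \<in> T" for t
    unfolding support_fun_def[of \<R> "trace_vec \<Upsilon>"] by (rule cSUP_least[OF R(2)]) (use U' that in fastforce)
  have "support_fun T (trace_vec \<Lambda>) \<le>
      c - Gamma_fun \<Q> \<Theta> - support_fun \<R> (trace_vec \<Upsilon>') - support_fun \<R> (trace_vec \<Upsilon>)"
    unfolding support_fun_def[of T] by (rule cSUP_least[OF T(2)]) (use U in fastforce)
  then show ?L by (simp add: objective_def)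
qed


section \<open>The risk bound\<close>

lemma trace_mult_eq: "trace (Q ** \<Theta>) = (\<Sum>i\<in>UNIV. \<Sum>j\<in>UNIV. Q $ i $ j * \<Theta> $ j $ i)"
  by (simp add: trace_def matrix_matrix_mult_def)

lemma quadratic_form_vec: "x \<bullet> (A *v x) = (\<Sum>i\<in>UNIV. \<Sum>j\<in>UNIV. x $ i * x $ j * A $ i $ j)"
  for A :: "real^'n^'n"
  by (simp add: inner_vec_def matrix_vector_mult_def sum_distrib_left ac_simps)

lemma transpose_eq_iff: "transpose A = A \<longleftrightarrow> (\<forall>i j. A $ i $ j = A $ j $ i)"
  by (auto simp: transpose_def Finite_Cartesian_Product.vec_eq_iff)

lemma psd_iff:
  "psd A \<longleftrightarrow> (\<forall>i j. A $ i $ j = A $ j $ i) \<and> (\<forall>v. 0 \<le> (\<Sum>i\<in>UNIV. \<Sum>j\<in>UNIV. v i * v j * A $ i $ j))"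
proof -
  have "(\<forall>x. 0 \<le> x \<bullet> (A *v x)) \<longleftrightarrow> (\<forall>v. 0 \<le> (\<Sum>i\<in>UNIV. \<Sum>j\<in>UNIV. v i * v j * A $ i $ j))" (is "?L \<longleftrightarrow> ?R")
  proof
    assume L: ?L
    show ?R
    proof
      fix v :: "'a \<Rightarrow> real"
      show "0 \<le> (\<Sum>i\<in>UNIV. \<Sum>j\<in>UNIV. v i * v j * A $ i $ j)"
        using L[rule_format, of "\<chi> i. v i"] by (simp add: quadratic_form_vec)
    qed
  qed (simp add: quadratic_form_vec)
  then show ?thesis by (simp add: psd_def transpose_eq_iff)
qed

lemma pos_def_imp_psd: "pos_def A \<Longrightarrow> psd A"
  unfolding pos_def_def psd_def by (metis inner_zero_left less_eq_real_def)

lemma trace_mult_psd_nonneg: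
  assumes "psd P" "psd Q" shows "0 \<le> trace (P ** Q)"
proof -
  have "0 \<le> (\<Sum>i\<in>UNIV. \<Sum>j\<in>UNIV. P $ i $ j * Q $ i $ j)"
    by (rule trace_prod_psd_nonneg) (use assms in \<open>auto simp: psd_iff\<close>)
  also have "\<dots> = trace (P ** Q)"
    unfolding trace_mult_eq by (intro sum.cong refl) (use assms in \<open>auto simp: psd_iff\<close>)
  finally show ?thesis .
qed

lemma trace_mult_diff: "trace ((P - Q) ** \<Theta>) = trace (P ** \<Theta>) - trace (Q ** \<Theta>)"
  for \<Theta> :: "real^'n^'n"
  by (simp add: trace_mult_eq left_diff_distrib sum_subtractf)

lemma quadratic_form_integral:
  fixes P :: "(real^'m) measure"
  assumes int: "\<And>i j. integrable P (\<lambda>\<xi>. \<xi> $ i * \<xi> $ j)" and sym: "transpose \<Theta> = \<Theta>"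
  shows "integrable P (\<lambda>\<xi>. \<xi> \<bullet> (\<Theta> *v \<xi>))"
    and "(\<integral>\<xi>. \<xi> \<bullet> (\<Theta> *v \<xi>) \<partial>P) = trace ((\<chi> i j. \<integral>\<xi>. \<xi> $ i * \<xi> $ j \<partial>P) ** \<Theta>)"
  using int sym unfolding quadratic_form_vec trace_mult_eq
  by (auto simp: integrable_sum transpose_eq_iff Bochner_Integration.integral_sum intro!: sum.cong)

lemma spec_form_zero: "spec_form d F Z 0 = 0"
  using spec_form_scale[of d F Z 0 0] by simp

lemma monotonic_set_props:
  assumes "monotonic_set T"
  shows "compact T" "T \<noteq> {}" "0 \<in> T" "\<exists>t\<in>T. \<forall>k. 0 < t $ k" "\<And>t k. t \<in> T \<Longrightarrow> 0 \<le> t $ k"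
proof -
  have c: "compact T" "\<exists>t\<in>T. \<forall>k. 0 < t $ k" and nn: "\<forall>t\<in>T. 0 \<le> t"
    and down: "\<forall>t\<in>T. \<forall>t'. 0 \<le> t' \<and> t' \<le> t \<longrightarrow> t' \<in> T"
    using assms unfolding monotonic_set_def by - (elim conjE, assumption)+
  show "compact T" "\<exists>t\<in>T. \<forall>k. 0 < t $ k" by (fact c)+
  show "\<And>t k. t \<in> T \<Longrightarrow> 0 \<le> t $ k" using nn by (auto simp: Finite_Cartesian_Product.less_eq_vec_def)
  obtain t where t: "t \<in> T" using c(2) by auto
  then show "T \<noteq> {}" by auto
  show "0 \<in> T" using down[rule_format, OF t, of 0] nn[rule_format, OF t] by simp
qed

lemma spec_form_sum_le_support:
  assumes T: "compact T" and Z: "\<And>k. psd_mat (d k) (Z k)" and x: "x \<in> basic_spectratope d T F"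
  shows "(\<Sum>k\<in>UNIV. spec_form (d k) (F k) (Z k) x) \<le> support_fun T (trace_vec Z)"
proof -
  obtain t where t: "t \<in> T"
    "\<And>k. psd_mat (d k) (t $ k \<cdot>\<^sub>m 1\<^sub>m (d k) - lin_mat (d k) (F k) x * lin_mat (d k) (F k) x)"
    using x by (auto simp: basic_spectratope_def)
  have "(\<Sum>k\<in>UNIV. spec_form (d k) (F k) (Z k) x) \<le> (\<Sum>k\<in>UNIV. t $ k * tr_mat (Z k))"
    by (intro sum_mono spec_form_le Z t)
  also have "\<dots> = trace_vec Z \<bullet> t" by (simp add: trace_vec_def inner_vec_def mult.commute)
  also have "\<dots> \<le> support_fun T (trace_vec Z)" by (rule support_fun_upper[OF T t(1)])
  finally show ?thesis .
qed

lemma feasible_theta_psd: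
  assumes "\<And>k i. R k i \<in> carrier_mat (d k) (d k)" "\<And>l i. S l i \<in> carrier_mat (f l) (f l)"
    and "feasible A B M d R f S (H, \<Lambda>, \<Upsilon>, \<Upsilon>', \<Theta>)"
  shows "psd \<Theta>"
proof -
  have *: "transpose \<Theta> = \<Theta>"
    "\<And>\<xi> y. 0 \<le> \<xi> \<bullet> (\<Theta> *v \<xi>) + \<xi> \<bullet> (H *v (M *v y)) + (\<Sum>l\<in>UNIV. spec_form (f l) (S l) (\<Upsilon>' l) y)"
    using assms(3) feasible_iff[of R d S f, OF assms(1,2)] by blast+
  show ?thesis using *(1) *(2)[of _ 0] by (simp add: psd_def spec_form_zero)
qed

lemma risk_le_objective:
  fixes A :: "real^'n^'m" and B :: "real^'n^'v" and M :: "real^'q^'v"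
  assumes R: "spectratope_data d T R" and N: "is_norm N" and S: "spectratope_data f \<R> S"
    and ball: "{z. conj_norm N z \<le> 1} = (\<lambda>y. M *v y) ` basic_spectratope f \<R> S"
    and Q: "compact \<Q>" and feas: "feasible A B M d R f S (H, \<Lambda>, \<Upsilon>, \<Upsilon>', \<Theta>)"
  shows "risk A B N (basic_spectratope d T R) \<Q> (\<lambda>\<omega>. transpose H *v \<omega>)
    \<le> ennreal (objective T \<R> \<Q> (H, \<Lambda>, \<Upsilon>, \<Upsilon>', \<Theta>))"
proof -
  have cR: "R k i \<in> carrier_mat (d k) (d k)" and cS: "S l i' \<in> carrier_mat (f l) (f l)" for k i l i'
    using R S by (auto simp: spectratope_data_def sym_mat_def)
  have T: "compact T" and RR: "compact \<R>"
    using R S monotonic_set_props(1) by (auto simp: spectratope_data_def)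
  note feas' = feas[unfolded feasible_iff[of R d S f, OF cR cS]]
  have psd: "\<And>k. psd_mat (d k) (\<Lambda> k)" "\<And>l. psd_mat (f l) (\<Upsilon> l)" "\<And>l. psd_mat (f l) (\<Upsilon>' l)"
    and sym: "transpose \<Theta> = \<Theta>"
    using feas' by blast+
  have signal: "0 \<le> (\<Sum>k\<in>UNIV. spec_form (d k) (R k) (\<Lambda> k) x)
        + (B *v x - transpose H *v (A *v x)) \<bullet> (M *v y) + (\<Sum>l\<in>UNIV. spec_form (f l) (S l) (\<Upsilon> l) y)" for x y
    using feas' by blast
  have noise: "0 \<le> \<xi> \<bullet> (\<Theta> *v \<xi>) + \<xi> \<bullet> (H *v (M *v y)) + (\<Sum>l\<in>UNIV. spec_form (f l) (S l) (\<Upsilon>' l) y)" for \<xi> y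
    using feas' by blast
  have \<Theta>: "psd \<Theta>" by (rule feasible_theta_psd[of R d S f, OF cR cS feas])
  let ?c = "support_fun T (trace_vec \<Lambda>) + support_fun \<R> (trace_vec \<Upsilon>) + support_fun \<R> (trace_vec \<Upsilon>')"
  have pointwise: "N (transpose H *v (A *v x + \<xi>) - B *v x) \<le> ?c + \<xi> \<bullet> (\<Theta> *v \<xi>)"
    if x: "x \<in> basic_spectratope d T R" for x \<xi>
  proof (rule norm_le_by_duality[OF N])
    fix z assume "conj_norm N z \<le> 1"
    then obtain y where y: "y \<in> basic_spectratope f \<R> S" "z = M *v y" using ball by blast
    have "z \<bullet> (transpose H *v (A *v x + \<xi>) - B *v x) =
      - ((B *v x - transpose H *v (A *v x)) \<bullet> (M *v y)) - ((- \<xi>) \<bullet> (H *v (M *v y)))"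
      by (simp add: y(2) matrix_vector_right_distrib inner_diff_left inner_diff_right inner_add_right
          inner_transpose[of \<xi>] inner_commute del: transpose_matrix_vector)
    also have "\<dots> \<le> (\<Sum>k\<in>UNIV. spec_form (d k) (R k) (\<Lambda> k) x) + (\<Sum>l\<in>UNIV. spec_form (f l) (S l) (\<Upsilon> l) y)
       + (\<xi> \<bullet> (\<Theta> *v \<xi>) + (\<Sum>l\<in>UNIV. spec_form (f l) (S l) (\<Upsilon>' l) y))"
    proof -
      have "(- \<xi>) \<bullet> (\<Theta> *v (- \<xi>)) = \<xi> \<bullet> (\<Theta> *v \<xi>)" by (simp add: quadratic_form_vec)
      then show ?thesis using signal[of x y] noise[of "- \<xi>" y] by linarith
    qed
    also have "\<dots> \<le> ?c + \<xi> \<bullet> (\<Theta> *v \<xi>)"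
      using spec_form_sum_le_support[OF T psd(1) x] spec_form_sum_le_support[OF RR psd(2) y(1)]
        spec_form_sum_le_support[OF RR psd(3) y(1)] by linarith
    finally show "z \<bullet> (transpose H *v (A *v x + \<xi>) - B *v x) \<le> ?c + \<xi> \<bullet> (\<Theta> *v \<xi>)" .
  qed
  have "(\<integral>\<^sup>+ \<xi>. ennreal (N (transpose H *v (A *v x + \<xi>) - B *v x)) \<partial>P)
      \<le> ennreal (objective T \<R> \<Q> (H, \<Lambda>, \<Upsilon>, \<Upsilon>', \<Theta>))"
    if x: "x \<in> basic_spectratope d T R" and P: "prob_space P" and dom: "cov_dominated P \<Q>" for x P
  proof -
    interpret prob_space P by (rule P)
    let ?C = "\<chi> i j. \<integral>\<xi>. \<xi> $ i * \<xi> $ j \<partial>P"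
    have int: "\<And>i j. integrable P (\<lambda>\<xi>. \<xi> $ i * \<xi> $ j)" using dom by (simp add: cov_dominated_def)
    obtain Q where Q': "Q \<in> \<Q>" "psd (Q - ?C)" using dom by (auto simp: cov_dominated_def)
    note qi = quadratic_form_integral[OF int sym]
    have "trace (?C ** \<Theta>) \<le> trace (Q ** \<Theta>)"
      using trace_mult_psd_nonneg[OF Q'(2) \<Theta>] by (simp add: trace_mult_diff)
    also have "\<dots> \<le> Gamma_fun \<Q> \<Theta>" by (rule Gamma_fun_upper[OF Q Q'(1)])
    finally have tr: "trace (?C ** \<Theta>) \<le> Gamma_fun \<Q> \<Theta>" .
    have nn: "0 \<le> ?c + \<xi> \<bullet> (\<Theta> *v \<xi>)" for \<xi>
    proof -
      have "0 \<le> N (transpose H *v (A *v x + \<xi>) - B *v x)" using N unfolding is_norm_def by blast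
      then show ?thesis using pointwise[OF x, of \<xi>] by linarith
    qed
    have "(\<integral>\<^sup>+ \<xi>. ennreal (N (transpose H *v (A *v x + \<xi>) - B *v x)) \<partial>P)
      \<le> (\<integral>\<^sup>+ \<xi>. ennreal (?c + \<xi> \<bullet> (\<Theta> *v \<xi>)) \<partial>P)"
      by (intro nn_integral_mono ennreal_leI pointwise x)
    also have "\<dots> = ennreal (\<integral>\<xi>. ?c + \<xi> \<bullet> (\<Theta> *v \<xi>) \<partial>P)"
      by (rule nn_integral_eq_integral) (use qi(1) nn in auto)
    also have "(\<integral>\<xi>. ?c + \<xi> \<bullet> (\<Theta> *v \<xi>) \<partial>P) = ?c + trace (?C ** \<Theta>)"
      using qi by (simp add: prob_space)
    also have "ennreal \<dots> \<le> ennreal (objective T \<R> \<Q> (H, \<Lambda>, \<Upsilon>, \<Upsilon>', \<Theta>))"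
      using tr by (intro ennreal_leI) (simp add: objective_def)
    finally show ?thesis .
  qed
  then show ?thesis unfolding risk_def by (intro SUP_least) auto
qed


section \<open>Feasibility\<close>

lemma spec_form_smult:
  assumes "Z \<in> carrier_mat d d"
  shows "spec_form d F (c \<cdot>\<^sub>m Z) x = c * spec_form d F Z x"
  using assms unfolding spec_form_def sum_distrib_left
  by (intro sum.cong refl) (simp add: mult.assoc del: index_mult_mat(1))

lemma psd_mat_one: "0 \<le> \<alpha> \<Longrightarrow> psd_mat d (\<alpha> \<cdot>\<^sub>m 1\<^sub>m d)"
proof -
  assume \<alpha>: "0 \<le> \<alpha>"
  have "(\<Sum>a<d. \<Sum>b<d. v a * v b * (\<alpha> \<cdot>\<^sub>m 1\<^sub>m d) $$ (a, b)) = \<alpha> * (\<Sum>a<d. (v a)\<^sup>2)" for v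
  proof -
    have "(\<Sum>a<d. \<Sum>b<d. v a * v b * (\<alpha> \<cdot>\<^sub>m 1\<^sub>m d) $$ (a, b)) = (\<Sum>a<d. \<Sum>b<d. if b = a then \<alpha> * (v a * v a) else 0)"
      by (intro sum.cong refl) auto
    then show ?thesis by (simp add: sum_distrib_left power2_eq_square)
  qed
  moreover have "\<forall>a<d. \<forall>b<d. (\<alpha> \<cdot>\<^sub>m 1\<^sub>m d) $$ (a, b) = (\<alpha> \<cdot>\<^sub>m 1\<^sub>m d) $$ (b, a)"
    by auto
  ultimately show ?thesis using \<alpha> unfolding psd_mat_iff by (auto simp del: index_smult_mat(1) intro!: mult_nonneg_nonneg sum_nonneg)
qed

lemma spectratope_form_lower_bound:
  assumes "spectratope_data d T R"
  obtains \<epsilon> where "0 < \<epsilon>" "\<And>x. \<epsilon> * (norm x)\<^sup>2 \<le> (\<Sum>k\<in>UNIV. spec_form (d k) (R k) (1 \<cdot>\<^sub>m 1\<^sub>m (d k)) x)"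
proof (rule pos_homogeneous_lower_bound[of "\<lambda>x. \<Sum>k\<in>UNIV. spec_form (d k) (R k) (1 \<cdot>\<^sub>m 1\<^sub>m (d k)) x" 2])
  show "continuous_on UNIV (\<lambda>x. \<Sum>k\<in>UNIV. spec_form (d k) (R k) (1 \<cdot>\<^sub>m 1\<^sub>m (d k)) x)"
    by (intro continuous_on_sum spec_form_continuous)
  have form: "spec_form (d k) (R k) (1 \<cdot>\<^sub>m 1\<^sub>m (d k)) x = (\<Sum>a<d k. \<Sum>c<d k. (lin_mat (d k) (R k) x $$ (a, c))\<^sup>2)" for k x
    using assms spec_form_one[of "d k" "R k" 1 x] by (simp add: spectratope_data_def)
  show "0 < (\<Sum>k\<in>UNIV. spec_form (d k) (R k) (1 \<cdot>\<^sub>m 1\<^sub>m (d k)) x)" if x: "x \<noteq> 0" for x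
  proof -
    obtain k where k: "lin_mat (d k) (R k) x \<noteq> 0\<^sub>m (d k) (d k)"
      using assms x by (auto simp: spectratope_data_def)
    then obtain a c where ac: "a < d k" "c < d k" "lin_mat (d k) (R k) x $$ (a, c) \<noteq> 0"
      by (metis eq_matI index_zero_mat lin_mat_carrier(2,3))
    have "0 < spec_form (d k) (R k) (1 \<cdot>\<^sub>m 1\<^sub>m (d k)) x"
    proof -
      have "0 < (lin_mat (d k) (R k) x $$ (a, c))\<^sup>2" using ac by simp
      also have "\<dots> \<le> (\<Sum>c<d k. (lin_mat (d k) (R k) x $$ (a, c))\<^sup>2)"
        by (rule member_le_sum[where f = "\<lambda>c. (lin_mat (d k) (R k) x $$ (a, c))\<^sup>2"]) (use ac in auto)
      also have "\<dots> \<le> (\<Sum>a<d k. \<Sum>c<d k. (lin_mat (d k) (R k) x $$ (a, c))\<^sup>2)"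
        by (rule member_le_sum[where f = "\<lambda>a. \<Sum>c<d k. (lin_mat (d k) (R k) x $$ (a, c))\<^sup>2"])
          (use ac in \<open>auto intro!: sum_nonneg\<close>)
      finally show ?thesis unfolding form .
    qed
    then show ?thesis
      by (intro sum_pos2[of _ k]) (auto simp: form intro!: sum_nonneg)
  qed
qed (auto simp: spec_form_scale sum_distrib_left intro: that)

lemma transpose_zero: "transpose (0 :: real^'a^'b) = 0"
  by (simp add: transpose_def Finite_Cartesian_Product.vec_eq_iff)

lemma feasible_exists:
  fixes A :: "real^'n^'m" and B :: "real^'n^'v" and M :: "real^'q^'v"
  assumes R: "spectratope_data d T R" and S: "spectratope_data f \<R> S"
  obtains s where "feasible A B M d R f S s"
proof -
  have cR: "R k i \<in> carrier_mat (d k) (d k)" and cS: "S l i' \<in> carrier_mat (f l) (f l)" for k i l i'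
    using R S by (auto simp: spectratope_data_def sym_mat_def)
  obtain \<epsilon> where \<epsilon>: "0 < \<epsilon>" "\<And>x. \<epsilon> * (norm x)\<^sup>2 \<le> (\<Sum>k\<in>UNIV. spec_form (d k) (R k) (1 \<cdot>\<^sub>m 1\<^sub>m (d k)) x)"
    using spectratope_form_lower_bound[OF R] by blast
  obtain \<delta> where \<delta>: "0 < \<delta>" "\<And>y. \<delta> * (norm y)\<^sup>2 \<le> (\<Sum>l\<in>UNIV. spec_form (f l) (S l) (1 \<cdot>\<^sub>m 1\<^sub>m (f l)) y)"
    using spectratope_form_lower_bound[OF S] by blast
  obtain KB where KB: "0 \<le> KB" "\<And>x. norm (B *v x) \<le> norm x * KB"
    using bounded_linear.nonneg_bounded[OF matrix_vector_mul_bounded_linear[of B]] by blast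
  obtain KM where KM: "0 \<le> KM" "\<And>y. norm (M *v y) \<le> norm y * KM"
    using bounded_linear.nonneg_bounded[OF matrix_vector_mul_bounded_linear[of M]] by blast
  define \<alpha> where "\<alpha> = KB * KM / min \<epsilon> \<delta>"
  have \<alpha>: "0 \<le> \<alpha>" "KB * KM \<le> \<alpha> * \<epsilon>" "KB * KM \<le> \<alpha> * \<delta>"
  proof -
    have "\<alpha> * min \<epsilon> \<delta> = KB * KM" using \<epsilon>(1) \<delta>(1) by (simp add: \<alpha>_def)
    moreover show "0 \<le> \<alpha>" using \<epsilon>(1) \<delta>(1) KB(1) KM(1) by (simp add: \<alpha>_def)
    ultimately show "KB * KM \<le> \<alpha> * \<epsilon>" "KB * KM \<le> \<alpha> * \<delta>"
      by (metis min.cobounded1 mult_left_mono, metis min.cobounded2 mult_left_mono)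
  qed
  have scale: "spec_form n F (\<alpha> \<cdot>\<^sub>m 1\<^sub>m n) x = \<alpha> * spec_form n F (1 \<cdot>\<^sub>m 1\<^sub>m n) x"
    for n and F :: "'z::finite \<Rightarrow> real mat" and x
    using spec_form_smult[of "1\<^sub>m n" n F _ x] by simp
  have zero: "spec_form n F (0 \<cdot>\<^sub>m 1\<^sub>m n) x = 0" for n and F :: "'z::finite \<Rightarrow> real mat" and x
    using spec_form_smult[of "1\<^sub>m n" n F 0 x] by simp
  have main: "0 \<le> (\<Sum>k\<in>UNIV. spec_form (d k) (R k) (\<alpha> \<cdot>\<^sub>m 1\<^sub>m (d k)) x) + (B *v x) \<bullet> (M *v y)
      + (\<Sum>l\<in>UNIV. spec_form (f l) (S l) (\<alpha> \<cdot>\<^sub>m 1\<^sub>m (f l)) y)" for x y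
  proof -
    have "\<bar>(B *v x) \<bullet> (M *v y)\<bar> \<le> norm (B *v x) * norm (M *v y)" by (rule Cauchy_Schwarz_ineq2)
    also have "\<dots> \<le> (norm x * KB) * (norm y * KM)"
      using KB KM by (intro mult_mono) auto
    also have "\<dots> = (KB * KM) * (norm x * norm y)" by simp
    also have "\<dots> \<le> (KB * KM) * ((norm x)\<^sup>2 + (norm y)\<^sup>2)"
    proof (rule mult_left_mono)
      have "2 * (norm x * norm y) \<le> (norm x)\<^sup>2 + (norm y)\<^sup>2" using sum_squares_bound[of "norm x" "norm y"] by simp
      moreover have "0 \<le> norm x * norm y" by simp
      ultimately show "norm x * norm y \<le> (norm x)\<^sup>2 + (norm y)\<^sup>2" by linarith
    qed (use KB KM in simp)
    also have "\<dots> \<le> (\<alpha> * \<epsilon>) * (norm x)\<^sup>2 + (\<alpha> * \<delta>) * (norm y)\<^sup>2"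
      using \<alpha> by (simp add: distrib_left add_mono mult_right_mono)
    also have "\<dots> \<le> (\<Sum>k\<in>UNIV. spec_form (d k) (R k) (\<alpha> \<cdot>\<^sub>m 1\<^sub>m (d k)) x)
      + (\<Sum>l\<in>UNIV. spec_form (f l) (S l) (\<alpha> \<cdot>\<^sub>m 1\<^sub>m (f l)) y)"
      unfolding scale sum_distrib_left[symmetric] mult.assoc
      by (intro add_mono mult_left_mono \<epsilon> \<delta> \<alpha>)
    finally show ?thesis by (simp only: abs_le_iff) linarith
  qed
  have "feasible A B M d R f S (0, \<lambda>k. \<alpha> \<cdot>\<^sub>m 1\<^sub>m (d k), \<lambda>l. \<alpha> \<cdot>\<^sub>m 1\<^sub>m (f l), \<lambda>l. 0 \<cdot>\<^sub>m 1\<^sub>m (f l), 0)"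
    unfolding feasible_iff[of R d S f, OF cR cS]
    using main \<alpha>(1) by (simp add: psd_mat_one zero transpose_zero del: transpose_matrix_vector)
  then show ?thesis by (rule that)
qed

lemma spec_form_abs_le:
  assumes Z: "psd_mat d Z" and b: "tr_mat Z \<le> b"
  shows "spec_form d F Z x \<le> b * (\<Sum>a<d. \<Sum>c<d. \<bar>(lin_mat d F x * lin_mat d F x) $$ (c, a)\<bar>)"
  unfolding spec_form_def sum_distrib_left
proof (intro sum_mono)
  fix a c assume "a \<in> {..<d}" "c \<in> {..<d}"
  then have "\<bar>Z $$ (a, c)\<bar> \<le> b" using psd_mat_entry_bound[OF Z] b by fastforce
  then have "\<bar>Z $$ (a, c)\<bar> * \<bar>w\<bar> \<le> b * \<bar>w\<bar>" for w by (rule mult_right_mono) simp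
  then show "Z $$ (a, c) * (lin_mat d F x * lin_mat d F x) $$ (c, a) \<le> b * \<bar>(lin_mat d F x * lin_mat d F x) $$ (c, a)\<bar>"
    by (rule order.trans[OF abs_ge_self[of "Z $$ (a, c) * _", unfolded abs_mult]])
qed

lemma norm_matrix_le:
  fixes H :: "real^'v^'m"
  assumes "\<And>i j. \<bar>H $ i $ j\<bar> \<le> b" shows "norm H \<le> real CARD('m) * (real CARD('v) * b)"
proof -
  have "norm H \<le> (\<Sum>i\<in>UNIV. norm (H $ i))"
    unfolding norm_vec_def by (rule L2_set_le_sum) simp
  also have "\<dots> \<le> (\<Sum>i\<in>(UNIV::'m set). \<Sum>j\<in>(UNIV::'v set). b)"
    by (intro sum_mono order.trans[OF norm_le_l1_cart] assms)
  finally show ?thesis by simp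
qed

lemma trace_vec_inner_nonneg:
  assumes "\<And>k. 0 \<le> t $ k" "\<And>k. psd_mat (d k) (Z k)" shows "0 \<le> trace_vec Z \<bullet> t"
  unfolding inner_vec_def trace_vec_def
  using assms by (auto intro!: sum_nonneg mult_nonneg_nonneg tr_mat_psd_nonneg)

lemma tr_mat_le_of_inner_le:
  assumes t: "\<And>k. 0 < t $ k" and Z: "\<And>k. psd_mat (d k) (Z k)" and c: "trace_vec Z \<bullet> t \<le> c"
  shows "tr_mat (Z k) \<le> (\<Sum>k\<in>UNIV. c / t $ k)"
proof -
  have nn: "0 \<le> tr_mat (Z k) * t $ k" for k
    using t[of k] Z[of k] tr_mat_psd_nonneg by (simp add: less_imp_le)
  have c0: "0 \<le> c" using trace_vec_inner_nonneg[of t d Z] t Z c by (meson less_imp_le order.trans)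
  have "tr_mat (Z k) * t $ k \<le> trace_vec Z \<bullet> t"
    unfolding inner_vec_def trace_vec_def using nn
    by (simp add: member_le_sum[where f = "\<lambda>k. tr_mat (Z k) * t $ k"])
  then have "tr_mat (Z k) \<le> c / t $ k" using t[of k] c by (simp add: field_simps)
  also have "\<dots> \<le> (\<Sum>k\<in>UNIV. c / t $ k)"
    by (rule member_le_sum[where f = "\<lambda>k. c / t $ k"]) (use c0 t in \<open>auto simp: less_imp_le\<close>)
  finally show ?thesis .
qed

lemma trace_le_of_pos_def:
  assumes Q: "pos_def Q"
  obtains b where "0 < b" "\<And>\<Theta>. psd \<Theta> \<Longrightarrow> trace \<Theta> \<le> b * trace (Q ** \<Theta>)"
proof -
  have "continuous_on UNIV (\<lambda>x. x \<bullet> (Q *v x))" "\<And>c x. (c *\<^sub>R x) \<bullet> (Q *v (c *\<^sub>R x)) = \<bar>c\<bar> ^ 2 * (x \<bullet> (Q *v x))"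
    unfolding quadratic_form_vec
    by (auto intro!: continuous_intros sum.cong simp: sum_distrib_left power2_eq_square)
  moreover have "\<And>x. x \<noteq> 0 \<Longrightarrow> 0 < x \<bullet> (Q *v x)" using Q by (simp add: pos_def_def)
  ultimately obtain \<epsilon> where \<epsilon>: "0 < \<epsilon>" "\<And>x. \<epsilon> * (norm x)\<^sup>2 \<le> x \<bullet> (Q *v x)"
    using pos_homogeneous_lower_bound[of "\<lambda>x. x \<bullet> (Q *v x)" 2] by (metis zero_less_numeral)
  let ?E = "\<epsilon> *\<^sub>R Finite_Cartesian_Product.mat 1"
  have "psd (Q - ?E)"
  proof -
    have "transpose (Q - ?E) = Q - ?E"
      using Q by (auto simp: pos_def_def transpose_eq_iff Finite_Cartesian_Product.mat_def)
    moreover have "x \<bullet> ((Q - ?E) *v x) = x \<bullet> (Q *v x) - \<epsilon> * (norm x)\<^sup>2" for x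
      by (simp add: matrix_vector_mult_diff_rdistrib scaleR_matrix_vector_assoc[symmetric] inner_diff_right
          power2_norm_eq_inner)
    ultimately show ?thesis using \<epsilon>(2) by (simp add: psd_def)
  qed
  then have nn: "0 \<le> trace (Q ** \<Theta>) - trace (?E ** \<Theta>)" if "psd \<Theta>" for \<Theta>
    using trace_mult_psd_nonneg[OF _ that] trace_mult_diff by metis
  have E: "trace (?E ** \<Theta>) = \<epsilon> * trace \<Theta>" for \<Theta>
  proof -
    have "trace (?E ** \<Theta>) = (\<Sum>i\<in>UNIV. \<Sum>j\<in>UNIV. if j = i then \<epsilon> * \<Theta> $ i $ i else 0)"
      unfolding trace_mult_eq by (intro sum.cong refl) (auto simp: Finite_Cartesian_Product.mat_def)
    then show ?thesis by (simp add: trace_def sum_distrib_left)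
  qed
  have le: "\<epsilon> * trace \<Theta> \<le> trace (Q ** \<Theta>)" if "psd \<Theta>" for \<Theta>
    using nn[OF that] E[of \<Theta>] by linarith
  have "trace \<Theta> \<le> (1 / \<epsilon>) * trace (Q ** \<Theta>)" if "psd \<Theta>" for \<Theta>
    using le[OF that] \<epsilon>(1) by (simp add: field_simps)
  then show ?thesis using that[of "1 / \<epsilon>"] \<epsilon>(1) by simp
qed


section \<open>Existence of an optimal solution\<close>

lemma feasible_sublevel_bounded:
  fixes A :: "real^'n^'m" and B :: "real^'n^'v" and M :: "real^'q^'v"
  assumes R: "spectratope_data d T R" and S: "spectratope_data f \<R> S" and M: "surj (\<lambda>y. M *v y)"
    and Q: "compact \<Q>" "\<Q> \<noteq> {}" "\<forall>Q\<in>\<Q>. pos_def Q"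
  obtains b where "0 \<le> b"
    "\<And>H \<Lambda> \<Upsilon> \<Upsilon>' \<Theta>. feasible A B M d R f S (H, \<Lambda>, \<Upsilon>, \<Upsilon>', \<Theta>) \<Longrightarrow>
       objective T \<R> \<Q> (H, \<Lambda>, \<Upsilon>, \<Upsilon>', \<Theta>) \<le> c \<Longrightarrow>
       norm H \<le> b \<and> norm \<Theta> \<le> b \<and> (\<forall>k. tr_mat (\<Lambda> k) \<le> b) \<and> (\<forall>l. tr_mat (\<Upsilon> l) \<le> b) \<and> (\<forall>l. tr_mat (\<Upsilon>' l) \<le> b)"
proof -
  have cR: "R k i \<in> carrier_mat (d k) (d k)" and cS: "S l i' \<in> carrier_mat (f l) (f l)" for k i l i'
    using R S by (auto simp: spectratope_data_def sym_mat_def)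
  have mT: "monotonic_set T" and mR: "monotonic_set \<R>" using R S by (auto simp: spectratope_data_def)
  note propsT = monotonic_set_props[OF mT] and propsR = monotonic_set_props[OF mR]
  obtain t0 where t0: "t0 \<in> T" "\<And>k. 0 < t0 $ k" using propsT(4) by blast
  obtain r0 where r0: "r0 \<in> \<R>" "\<And>l. 0 < r0 $ l" using propsR(4) by blast
  obtain Q0 where Q0: "Q0 \<in> \<Q>" "pos_def Q0" using Q by blast
  obtain bQ where bQ: "0 < bQ" "\<And>\<Theta>. psd \<Theta> \<Longrightarrow> trace \<Theta> \<le> bQ * trace (Q0 ** \<Theta>)"
    using trace_le_of_pos_def[OF Q0(2)] by blast
  obtain w where w: "\<And>z. M *v w z = z" using M by (metis surj_f_inv_f)
  define G where "G l y = (\<Sum>a<f l. \<Sum>c<f l. \<bar>(lin_mat (f l) (S l) y * lin_mat (f l) (S l) y) $$ (c, a)\<bar>)" for l y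
  define b1 where "b1 = (\<Sum>k\<in>UNIV. c / t0 $ k)"
  define b2 where "b2 = (\<Sum>l\<in>UNIV. c / r0 $ l)"
  define \<beta> where "\<beta> = bQ * c + (\<Sum>j\<in>UNIV. \<Sum>l\<in>UNIV. b2 * G l (w (axis j 1)))"
  define b3 where "b3 = real CARD('m) * (real CARD('m) * (bQ * c))"
  define b4 where "b4 = real CARD('m) * (real CARD('v) * \<beta>)"
  have bound: "norm H \<le> b4 \<and> norm \<Theta> \<le> b3 \<and> (\<forall>k. tr_mat (\<Lambda> k) \<le> b1) \<and> (\<forall>l. tr_mat (\<Upsilon> l) \<le> b2) \<and> (\<forall>l. tr_mat (\<Upsilon>' l) \<le> b2)"
    if feas: "feasible A B M d R f S (H, \<Lambda>, \<Upsilon>, \<Upsilon>', \<Theta>)"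
      and obj: "objective T \<R> \<Q> (H, \<Lambda>, \<Upsilon>, \<Upsilon>', \<Theta>) \<le> c" for H \<Lambda> \<Upsilon> \<Upsilon>' \<Theta>
  proof -
    note feas' = feas[unfolded feasible_iff[of R d S f, OF cR cS]]
    have psd: "\<And>k. psd_mat (d k) (\<Lambda> k)" "\<And>l. psd_mat (f l) (\<Upsilon> l)" "\<And>l. psd_mat (f l) (\<Upsilon>' l)"
      using feas' by blast+
    have noise: "0 \<le> \<xi> \<bullet> (\<Theta> *v \<xi>) + \<xi> \<bullet> (H *v (M *v y)) + (\<Sum>l\<in>UNIV. spec_form (f l) (S l) (\<Upsilon>' l) y)" for \<xi> y
      using feas' by blast
    have \<Theta>: "psd \<Theta>" by (rule feasible_theta_psd[of R d S f, OF cR cS feas])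
    have nn: "0 \<le> trace_vec \<Lambda> \<bullet> t0" "0 \<le> trace_vec \<Upsilon> \<bullet> r0" "0 \<le> trace_vec \<Upsilon>' \<bullet> r0"
      "0 \<le> trace (Q0 ** \<Theta>)"
      using trace_vec_inner_nonneg[of t0 d \<Lambda>] trace_vec_inner_nonneg[of r0 f \<Upsilon>]
        trace_vec_inner_nonneg[of r0 f \<Upsilon>'] t0 r0 psd
        trace_mult_psd_nonneg[OF pos_def_imp_psd[OF Q0(2)] \<Theta>] by (auto simp: less_imp_le)
    have "trace_vec \<Lambda> \<bullet> t0 + trace_vec \<Upsilon> \<bullet> r0 + trace_vec \<Upsilon>' \<bullet> r0 + trace (Q0 ** \<Theta>) \<le> c"
      using obj t0(1) r0(1) Q0(1) unfolding objective_le_iff[OF propsT(1,2) propsR(1,2) Q(1,2)] by blast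
    then have le: "trace_vec \<Lambda> \<bullet> t0 \<le> c" "trace_vec \<Upsilon> \<bullet> r0 \<le> c" "trace_vec \<Upsilon>' \<bullet> r0 \<le> c"
      "trace (Q0 ** \<Theta>) \<le> c"
      using nn by linarith+
    have tr: "tr_mat (\<Lambda> k) \<le> b1" "tr_mat (\<Upsilon> l) \<le> b2" "tr_mat (\<Upsilon>' l) \<le> b2" for k l
      unfolding b1_def b2_def
      using tr_mat_le_of_inner_le[of t0 d \<Lambda>, OF t0(2) psd(1) le(1)]
        tr_mat_le_of_inner_le[of r0 f \<Upsilon>, OF r0(2) psd(2) le(2)]
        tr_mat_le_of_inner_le[of r0 f \<Upsilon>', OF r0(2) psd(3) le(3)] by blast+
    have b2: "0 \<le> b2" using tr(3) tr_mat_psd_nonneg[OF psd(3)] order.trans by blast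
    have "trace \<Theta> \<le> bQ * c"
      using bQ(2)[OF \<Theta>] mult_left_mono[OF le(4), of bQ] bQ(1) by linarith
    then have entry: "\<bar>\<Theta> $ i $ j\<bar> \<le> bQ * c" for i j
      using psd_entry_le_trace[of UNIV i j "\<lambda>i j. \<Theta> $ i $ j"] \<Theta>
      unfolding psd_iff trace_def by fastforce
    have "norm \<Theta> \<le> b3" unfolding b3_def by (rule norm_matrix_le[OF entry])
    moreover have "norm H \<le> b4"
      unfolding b4_def
    proof (rule norm_matrix_le)
      fix i j
      let ?w = "w (axis j 1)"
      have "(\<Sum>l\<in>UNIV. spec_form (f l) (S l) (\<Upsilon>' l) ?w) \<le> (\<Sum>l\<in>UNIV. b2 * G l ?w)"
        unfolding G_def by (intro sum_mono spec_form_abs_le psd tr)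
      also have "\<dots> \<le> (\<Sum>j\<in>UNIV. \<Sum>l\<in>UNIV. b2 * G l (w (axis j 1)))"
        by (rule member_le_sum[where f = "\<lambda>j. \<Sum>l\<in>UNIV. b2 * G l (w (axis j 1))"])
          (use b2 in \<open>auto simp: G_def intro!: sum_nonneg mult_nonneg_nonneg\<close>)
      finally have sp: "(\<Sum>l\<in>UNIV. spec_form (f l) (S l) (\<Upsilon>' l) ?w) \<le> \<dots>" .
      have q: "axis i 1 \<bullet> (\<Theta> *v axis i 1) = \<Theta> $ i $ i" "(- axis i 1) \<bullet> (\<Theta> *v (- axis i 1)) = \<Theta> $ i $ i"
        by (simp_all add: matrix_vector_mult_basis column_def inner_axis' mult_minus_right[symmetric]
            linear_neg[OF matrix_vector_mul_linear])
      have h: "axis i 1 \<bullet> (H *v (M *v ?w)) = H $ i $ j" "(- axis i 1) \<bullet> (H *v (M *v ?w)) = - H $ i $ j"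
        by (simp_all add: w matrix_vector_mult_basis column_def inner_axis')
      show "\<bar>H $ i $ j\<bar> \<le> \<beta>"
        using noise[of "axis i 1" ?w] noise[of "- axis i 1" ?w] sp entry[of i i]
        unfolding \<beta>_def q h by linarith
    qed
    ultimately show ?thesis using tr by blast
  qed
  let ?b = "max 0 (max b1 (max b2 (max b3 b4)))"
  show ?thesis
  proof (rule that[of ?b])
    show "norm H \<le> ?b \<and> norm \<Theta> \<le> ?b \<and> (\<forall>k. tr_mat (\<Lambda> k) \<le> ?b) \<and> (\<forall>l. tr_mat (\<Upsilon> l) \<le> ?b) \<and> (\<forall>l. tr_mat (\<Upsilon>' l) \<le> ?b)"
      if "feasible A B M d R f S (H, \<Lambda>, \<Upsilon>, \<Upsilon>', \<Theta>)"
      "objective T \<R> \<Q> (H, \<Lambda>, \<Upsilon>, \<Upsilon>', \<Theta>) \<le> c" for H \<Lambda> \<Upsilon> \<Upsilon>' \<Theta>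
      using bound[OF that] by (auto simp: le_max_iff_disj)
  qed simp
qed

lemma objective_nonneg:
  assumes R: "spectratope_data d T R" and S: "spectratope_data f \<R> S"
    and Q: "compact \<Q>" "\<Q> \<noteq> {}" "\<forall>Q\<in>\<Q>. pos_def Q"
    and feas: "feasible A B M d R f S (H, \<Lambda>, \<Upsilon>, \<Upsilon>', \<Theta>)"
  shows "0 \<le> objective T \<R> \<Q> (H, \<Lambda>, \<Upsilon>, \<Upsilon>', \<Theta>)"
proof -
  have cR: "R k i \<in> carrier_mat (d k) (d k)" and cS: "S l i' \<in> carrier_mat (f l) (f l)" for k i l i'
    using R S by (auto simp: spectratope_data_def sym_mat_def)
  have mT: "monotonic_set T" and mR: "monotonic_set \<R>" using R S by (auto simp: spectratope_data_def)
  obtain Q0 where Q0: "Q0 \<in> \<Q>" "pos_def Q0" using Q by blast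
  have "0 \<le> trace (Q0 ** \<Theta>)"
    by (rule trace_mult_psd_nonneg[OF pos_def_imp_psd[OF Q0(2)] feasible_theta_psd[of R d S f, OF cR cS feas]])
  moreover have "trace (Q0 ** \<Theta>) \<le> Gamma_fun \<Q> \<Theta>" by (rule Gamma_fun_upper[OF Q(1) Q0(1)])
  ultimately show ?thesis
    using support_fun_upper[OF monotonic_set_props(1,3)[OF mT], of "trace_vec \<Lambda>"]
      support_fun_upper[OF monotonic_set_props(1,3)[OF mR], of "trace_vec \<Upsilon>"]
      support_fun_upper[OF monotonic_set_props(1,3)[OF mR], of "trace_vec \<Upsilon>'"]
    by (simp add: objective_def)
qed

lemma compact_coordinate_box: "compact {x :: 'i \<Rightarrow> real. \<forall>i. \<bar>x i\<bar> \<le> b}"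
proof -
  have "compactin (product_topology (\<lambda>i. euclidean) UNIV) (PiE (UNIV :: 'i set) (\<lambda>i. {-b..b}))"
    unfolding compactin_PiE by (auto simp: compactin_euclidean_iff)
  then have "compact (PiE (UNIV :: 'i set) (\<lambda>i. {-b..b}))"
    by (simp add: euclidean_product_topology compactin_euclidean_iff)
  also have "PiE (UNIV :: 'i set) (\<lambda>i. {-b..b}) = {x. \<forall>i. \<bar>x i\<bar> \<le> b}"
    by (auto simp: PiE_def Pi_def abs_le_iff; smt (verit))
  finally show ?thesis .
qed

text \<open>Families of matrices are encoded as functions into the reals, where the product topology makes
  boxes compact by Tychonoff's theorem. The objective enters through its epigraph, so that only closed
  conditions occur and no continuity of the support functions is needed.\<close>
definition mat_block :: "('k \<Rightarrow> nat) \<Rightarrow> ('k \<times> nat \<times> nat \<Rightarrow> real) \<Rightarrow> 'k \<Rightarrow> real mat" where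
  "mat_block d x k = Matrix.mat (d k) (d k) (\<lambda>(a, b). x (k, a, b))"

definition mat_entries :: "('k \<Rightarrow> nat) \<Rightarrow> ('k \<Rightarrow> real mat) \<Rightarrow> 'k \<times> nat \<times> nat \<Rightarrow> real" where
  "mat_entries d Z = (\<lambda>(k, a, b). if a < d k \<and> b < d k then Z k $$ (a, b) else 0)"

lemma mat_block_entries:
  assumes "\<And>k. Z k \<in> carrier_mat (d k) (d k)" shows "mat_block d (mat_entries d Z) = Z"
proof
  fix k show "mat_block d (mat_entries d Z) k = Z k"
    by (rule eq_matI) (use assms[of k] in \<open>auto simp: mat_block_def mat_entries_def\<close>)
qed

lemma mat_entries_bound:
  assumes "\<And>k. psd_mat (d k) (Z k)" "\<And>k. tr_mat (Z k) \<le> b" "0 \<le> b"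
  shows "\<bar>mat_entries d Z i\<bar> \<le> b"
proof (cases i)
  case (fields k a c)
  show ?thesis
  proof (cases "a < d k \<and> c < d k")
    case True
    then have "\<bar>Z k $$ (a, c)\<bar> \<le> tr_mat (Z k)" using psd_mat_entry_bound[OF assms(1)] by blast
    then show ?thesis using True assms(2)[of k] by (simp add: fields mat_entries_def)
  qed (use assms(3) in \<open>auto simp: fields mat_entries_def\<close>)
qed

lemma psd_mat_block:
  "psd_mat (d k) (mat_block d x k) \<longleftrightarrow> (\<forall>a b. a < d k \<longrightarrow> b < d k \<longrightarrow> x (k, a, b) = x (k, b, a)) \<and>
     (\<forall>v. 0 \<le> (\<Sum>a<d k. \<Sum>b<d k. v a * v b * x (k, a, b)))"
proof -
  have "(\<Sum>a<d k. \<Sum>b<d k. v a * v b * mat_block d x k $$ (a, b))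
      = (\<Sum>a<d k. \<Sum>b<d k. v a * v b * x (k, a, b))" for v
    by (intro sum.cong refl) (simp add: mat_block_def)
  then show ?thesis unfolding psd_mat_iff by (auto simp: mat_block_def)
qed

lemma spec_form_block: "spec_form (d k) F (mat_block d x k) y =
    (\<Sum>a<d k. \<Sum>b<d k. x (k, a, b) * (lin_mat (d k) F y * lin_mat (d k) F y) $$ (b, a))"
  unfolding spec_form_def by (intro sum.cong refl) (simp add: mat_block_def)

lemma trace_vec_block: "trace_vec (mat_block d x) \<bullet> t = (\<Sum>k\<in>UNIV. (\<Sum>a<d k. x (k, a, a)) * t $ k)"
  by (simp add: trace_vec_def inner_vec_def tr_mat_def mat_block_def)

lemma closed_feasible_epigraph:
  fixes A :: "real^'n^'m" and B :: "real^'n^'v" and M :: "real^'q^'v"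
    and d :: "'k::finite \<Rightarrow> nat" and f :: "'l::finite \<Rightarrow> nat"
  assumes R: "\<And>k i. R k i \<in> carrier_mat (d k) (d k)" and S: "\<And>l i. S l i \<in> carrier_mat (f l) (f l)"
    and T: "compact T" "T \<noteq> {}" and RR: "compact \<R>" "\<R> \<noteq> {}" and Q: "compact \<Q>" "\<Q> \<noteq> {}"
  shows "closed {(H, x, y, z, \<Theta>, c).
    feasible A B M d R f S (H, mat_block d x, mat_block f y, mat_block f z, \<Theta>) \<and>
    objective T \<R> \<Q> (H, mat_block d x, mat_block f y, mat_block f z, \<Theta>) \<le> c}"
  unfolding feasible_iff[of R d S f, OF R S] objective_le_iff[OF T RR Q] psd_mat_block spec_form_block
    trace_vec_block quadratic_form_vec trace_mult_eq transpose_eq_iff case_prod_beta Ball_def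
  unfolding matrix_vector_mult_def inner_vec_def transpose_def
  by (intro closed_Collect_conj closed_Collect_all closed_Collect_imp open_Collect_const
      closed_Collect_le closed_Collect_eq continuous_intros
      continuous_on_product_then_coordinatewise)

lemma optimal_solution_exists:
  fixes A :: "real^'n^'m" and B :: "real^'n^'v" and M :: "real^'q^'v"
    and d :: "'k::finite \<Rightarrow> nat" and f :: "'l::finite \<Rightarrow> nat"
  assumes R: "spectratope_data d T R" and S: "spectratope_data f \<R> S" and M: "surj (\<lambda>y. M *v y)"
    and Q: "compact \<Q>" "\<Q> \<noteq> {}" "\<forall>Q\<in>\<Q>. pos_def Q"
  obtains s where "feasible A B M d R f S s"
    "\<And>s'. feasible A B M d R f S s' \<Longrightarrow> objective T \<R> \<Q> s \<le> objective T \<R> \<Q> s'"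
proof -
  have cR: "R k i \<in> carrier_mat (d k) (d k)" and cS: "S l i' \<in> carrier_mat (f l) (f l)" for k i l i'
    using R S by (auto simp: spectratope_data_def sym_mat_def)
  have mT: "monotonic_set T" and mR: "monotonic_set \<R>" using R S by (auto simp: spectratope_data_def)
  obtain s0 where s0: "feasible A B M d R f S s0" using feasible_exists[OF R S, of A B M] by blast
  define c where "c = objective T \<R> \<Q> s0"
  obtain b where b: "0 \<le> b"
    "\<And>H \<Lambda> \<Upsilon> \<Upsilon>' \<Theta>. feasible A B M d R f S (H, \<Lambda>, \<Upsilon>, \<Upsilon>', \<Theta>) \<Longrightarrow>
       objective T \<R> \<Q> (H, \<Lambda>, \<Upsilon>, \<Upsilon>', \<Theta>) \<le> c \<Longrightarrow>
       norm H \<le> b \<and> norm \<Theta> \<le> b \<and> (\<forall>k. tr_mat (\<Lambda> k) \<le> b) \<and> (\<forall>l. tr_mat (\<Upsilon> l) \<le> b) \<and> (\<forall>l. tr_mat (\<Upsilon>' l) \<le> b)"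
    using feasible_sublevel_bounded[OF R S M Q, where c = c and A = A and B = B] by blast
  define C where "C = {(H, x, y, z, \<Theta>, c).
    feasible A B M d R f S (H, mat_block d x, mat_block f y, mat_block f z, \<Theta>) \<and>
    objective T \<R> \<Q> (H, mat_block d x, mat_block f y, mat_block f z, \<Theta>) \<le> c}"
  define box where "box = cball (0 :: real^'v^'m) b \<times> {x :: 'k \<times> nat \<times> nat \<Rightarrow> real. \<forall>i. \<bar>x i\<bar> \<le> b}
    \<times> {x :: 'l \<times> nat \<times> nat \<Rightarrow> real. \<forall>i. \<bar>x i\<bar> \<le> b} \<times> {x :: 'l \<times> nat \<times> nat \<Rightarrow> real. \<forall>i. \<bar>x i\<bar> \<le> b}
    \<times> cball (0 :: real^'m^'m) b \<times> {0..c}"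
  have encode: "\<exists>p \<in> box \<inter> C. snd (snd (snd (snd (snd p)))) = objective T \<R> \<Q> s"
    if s: "feasible A B M d R f S s" "objective T \<R> \<Q> s \<le> c" for s
  proof -
    obtain H \<Lambda> \<Upsilon> \<Upsilon>' \<Theta> where s_eq: "s = (H, \<Lambda>, \<Upsilon>, \<Upsilon>', \<Theta>)" by (metis prod.exhaust)
    have psd: "psd_mat (d k) (\<Lambda> k)" "psd_mat (f l) (\<Upsilon> l)" "psd_mat (f l) (\<Upsilon>' l)" for k l
      using s(1) by (auto simp: s_eq feasible_def)
    have dec: "mat_block d (mat_entries d \<Lambda>) = \<Lambda>" "mat_block f (mat_entries f \<Upsilon>) = \<Upsilon>"
      "mat_block f (mat_entries f \<Upsilon>') = \<Upsilon>'"
      using psd by (auto intro!: mat_block_entries simp: psd_mat_iff)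
    note bd = b(2)[OF s[unfolded s_eq]]
    have "(H, mat_entries d \<Lambda>, mat_entries f \<Upsilon>, mat_entries f \<Upsilon>', \<Theta>, objective T \<R> \<Q> s) \<in> box"
      unfolding box_def
      using bd s objective_nonneg[OF R S Q s(1)[unfolded s_eq]] mat_entries_bound[of d \<Lambda> b]
        mat_entries_bound[of f \<Upsilon> b] mat_entries_bound[of f \<Upsilon>' b] psd b(1)
      by (auto simp: s_eq)
    moreover have "(H, mat_entries d \<Lambda>, mat_entries f \<Upsilon>, mat_entries f \<Upsilon>', \<Theta>, objective T \<R> \<Q> s) \<in> C"
      unfolding C_def using s by (simp add: dec s_eq)
    ultimately show ?thesis by force
  qed
  have "closed C"
    unfolding C_def using closed_feasible_epigraph[of R d S f T \<R> \<Q>] cR cS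
      monotonic_set_props(1,2)[OF mT] monotonic_set_props(1,2)[OF mR] Q(1,2) by blast
  moreover have "compact box"
    unfolding box_def by (intro compact_Times compact_coordinate_box compact_cball compact_Icc)
  ultimately have "compact (box \<inter> C)" by (rule compact_Int_closed[rotated])
  moreover have "box \<inter> C \<noteq> {}" using encode[OF s0] by (auto simp: c_def)
  moreover have "continuous_on (box \<inter> C) (\<lambda>p. snd (snd (snd (snd (snd p)))))"
    by (intro continuous_intros)
  ultimately obtain p where p: "p \<in> box \<inter> C"
    "\<And>p'. p' \<in> box \<inter> C \<Longrightarrow> snd (snd (snd (snd (snd p)))) \<le> snd (snd (snd (snd (snd p'))))"
    using continuous_attains_inf[of "box \<inter> C" "\<lambda>p. snd (snd (snd (snd (snd p))))"] by blast
  obtain H x y z \<Theta> e where p_eq: "p = (H, x, y, z, \<Theta>, e)" by (metis prod.exhaust)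
  let ?s = "(H, mat_block d x, mat_block f y, mat_block f z, \<Theta>)"
  have s: "feasible A B M d R f S ?s" "objective T \<R> \<Q> ?s \<le> e" "e \<le> c"
    using p(1) by (auto simp: p_eq C_def box_def)
  have "objective T \<R> \<Q> ?s \<le> objective T \<R> \<Q> s'" if s': "feasible A B M d R f S s'" for s'
  proof (cases "objective T \<R> \<Q> s' \<le> c")
    case True
    then obtain p' where "p' \<in> box \<inter> C" "snd (snd (snd (snd (snd p')))) = objective T \<R> \<Q> s'"
      using encode[OF s'] by blast
    then have "e \<le> objective T \<R> \<Q> s'" using p(2) by (fastforce simp: p_eq)
    then show ?thesis using s(2) by simp
  qed (use s in simp)
  then show ?thesis using that s(1) by blast
qed

theorem proposition3p1:
  fixes A :: "real^'n^'m" and B :: "real^'n^'v" and M :: "real^'q^'v"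
    and d :: "'k::finite \<Rightarrow> nat" and T :: "(real^'k) set" and R :: "'k \<Rightarrow> 'n \<Rightarrow> real mat"
    and f :: "'l::finite \<Rightarrow> nat" and \<R> :: "(real^'l) set" and S :: "'l \<Rightarrow> 'q \<Rightarrow> real mat"
    and N :: "real^'v \<Rightarrow> real" and \<Q> :: "(real^'m^'m) set"
    and X :: "(real^'n) set" and Opt :: real
  assumes "spectratope_data d T R" and "X = basic_spectratope d T R"
    and "is_norm N"
    and "spectratope_data f \<R> S"
    and "{z. conj_norm N z \<le> 1} = (\<lambda>y. M *v y) ` basic_spectratope f \<R> S"
    and "\<Q> \<noteq> {}" and "convex \<Q>" and "compact \<Q>" and "\<forall>Q\<in>\<Q>. pos_def Q"
    and "Opt = (INF s\<in>{s. feasible A B M d R f S s}. objective T \<R> \<Q> s)"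
  shows "(\<exists>s. is_arg_min (objective T \<R> \<Q>) (feasible A B M d R f S) s \<and> objective T \<R> \<Q> s = Opt) \<and>
    (\<forall>H \<Lambda> \<Upsilon> \<Upsilon>' \<Theta>.
       is_arg_min (objective T \<R> \<Q>) (feasible A B M d R f S) (H, \<Lambda>, \<Upsilon>, \<Upsilon>', \<Theta>) \<longrightarrow>
       enn2ereal (risk A B N X \<Q> (\<lambda>\<omega>. transpose H *v \<omega>)) \<le> ereal Opt)"
proof -
  note R = assms(1) and N = assms(3) and S = assms(4) and ball = assms(5) and Q = assms(8,6,9)
  let ?obj = "objective T \<R> \<Q>" and ?feas = "feasible A B M d R f S"
  have "surj (\<lambda>y. M *v y)"
    by (rule conj_ball_image_surj[OF N]) (use ball in blast)
  then obtain s where s: "?feas s" "\<And>s'. ?feas s' \<Longrightarrow> ?obj s \<le> ?obj s'"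
    using optimal_solution_exists[OF R S _ Q, of M A B] by blast
  have Opt: "?obj s' = Opt" if "is_arg_min ?obj ?feas s'" for s'
  proof -
    have "?feas s'" "\<And>s''. ?feas s'' \<Longrightarrow> ?obj s' \<le> ?obj s''"
      using that by (auto simp: is_arg_min_linorder)
    then show ?thesis unfolding assms(10) by (intro cInf_eq_minimum[symmetric]) auto
  qed
  have "enn2ereal (risk A B N X \<Q> (\<lambda>\<omega>. transpose H *v \<omega>)) \<le> ereal Opt"
    if min: "is_arg_min ?obj ?feas (H, \<Lambda>, \<Upsilon>, \<Upsilon>', \<Theta>)" for H \<Lambda> \<Upsilon> \<Upsilon>' \<Theta>
  proof -
    have feas: "?feas (H, \<Lambda>, \<Upsilon>, \<Upsilon>', \<Theta>)" using min by (simp add: is_arg_min_def)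
    have "risk A B N X \<Q> (\<lambda>\<omega>. transpose H *v \<omega>) \<le> ennreal Opt"
      unfolding assms(2) Opt[OF min, symmetric] by (rule risk_le_objective[OF R N S ball Q(1) feas])
    then have "enn2ereal (risk A B N X \<Q> (\<lambda>\<omega>. transpose H *v \<omega>)) \<le> enn2ereal (ennreal Opt)"
      by (simp add: less_eq_ennreal.rep_eq)
    moreover have "0 \<le> Opt"
      using objective_nonneg[OF R S Q feas] Opt[OF min] by simp
    ultimately show ?thesis by (simp add: enn2ereal_ennreal)
  qed
  moreover have "is_arg_min ?obj ?feas s" using s by (auto simp: is_arg_min_linorder)
  ultimately show ?thesis using Opt by blast
qed

end
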